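(* Let $N\ge3$, $n\ge1$, let $a_1,\dots,a_n\in\mathbb{R}^N$, and let $A$ be a positive definite real symmetric $N\times N$ matrix. Then for every $\varphi\in H^1_\mu$, $$\frac{c_o}{n}\int_{\mathbb{R}^N}\sum_{i=1}^n\frac{\varphi^2}{|x-a_i|^2}\,d\mu\le\int_{\mathbb{R}^N}|\nabla\varphi|^2\,d\mu+\frac n2\operatorname{Tr}A\int_{\mathbb{R}^N}\varphi^2\,d\mu,$$ where $c_o=\left(\frac{N-2}{2}\right)^2$.
   Context: $d\mu=\mu(x)\,dx$ with $\mu(x)=C\,e^{-\frac12\sum_{i=1}^n\langle A(x-a_i),x-a_i\rangle}$ and $C$ the normalizing constant making $\mu$ a probability density. $L^2_\mu=L^2(\mathbb{R}^N,d\mu)$. $H^1_\mu$ is the space of $f\in L^2_\mu$ with distributional gradient in $(L^2_\mu)^N$; equivalently the completion of $C_c^\infty(\mathbb{R}^N)$ in the norm $\|u\|_{H^1_\mu}^2=\|u\|^2_{L^2_\mu}+\|\nabla u\|^2_{L^2_\mu}$. *)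

theory Defs
  imports "HOL-Analysis.Analysis"
begin

definition gauss_exp :: "real^'N^'N \<Rightarrow> nat \<Rightarrow> (nat \<Rightarrow> real^'N) \<Rightarrow> real^'N \<Rightarrow> real" where
  "gauss_exp A n a x = exp (- (1/2) * (\<Sum>i=1..n. (A *v (x - a i)) \<bullet> (x - a i)))"

definition mu_dens :: "real^'N^'N \<Rightarrow> nat \<Rightarrow> (nat \<Rightarrow> real^'N) \<Rightarrow> real^'N \<Rightarrow> real" where
  "mu_dens A n a x = gauss_exp A n a x / (\<integral>y. gauss_exp A n a y \<partial>lebesgue)"

definition pos_def_sym :: "real^'N^'N \<Rightarrow> bool" where
  "pos_def_sym A \<longleftrightarrow> transpose A = A \<and> (\<forall>x. x \<noteq> 0 \<longrightarrow> x \<bullet> (A *v x) > 0)"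

text \<open>Partial derivative in direction e_j (value of the derivative; existence is required separately).\<close>
definition pderiv_dir :: "'N \<Rightarrow> (real^'N \<Rightarrow> real) \<Rightarrow> real^'N \<Rightarrow> real" where
  "pderiv_dir j f x = deriv (\<lambda>t. f (x + t *\<^sub>R axis j 1)) 0"

fun pderivs :: "'N list \<Rightarrow> (real^'N \<Rightarrow> real) \<Rightarrow> real^'N \<Rightarrow> real" where
  "pderivs [] f = f"
| "pderivs (j # js) f = pderiv_dir j (pderivs js f)"

definition C_infty :: "(real^'N \<Rightarrow> real) \<Rightarrow> bool" where
  "C_infty f \<longleftrightarrow> (\<forall>js. continuous_on UNIV (pderivs js f) \<and>
      (\<forall>j x. (\<lambda>t. pderivs js f (x + t *\<^sub>R axis j 1)) differentiable (at 0)))"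

definition test_fun :: "(real^'N \<Rightarrow> real) \<Rightarrow> bool" where
  "test_fun f \<longleftrightarrow> C_infty f \<and> (\<exists>K. compact K \<and> (\<forall>x. x \<notin> K \<longrightarrow> f x = 0))"

definition weak_gradient :: "(real^'N \<Rightarrow> real) \<Rightarrow> (real^'N \<Rightarrow> real^'N) \<Rightarrow> bool" where
  "weak_gradient f g \<longleftrightarrow>
     f \<in> borel_measurable lebesgue \<and> g \<in> borel_measurable lebesgue \<and>
     (\<forall>K. compact K \<longrightarrow> set_integrable lebesgue K f \<and> (\<forall>j. set_integrable lebesgue K (\<lambda>x. g x $ j))) \<and>
     (\<forall>\<psi> j. test_fun \<psi> \<longrightarrow>
        (\<integral>x. f x * pderiv_dir j \<psi> x \<partial>lebesgue) = - (\<integral>x. g x $ j * \<psi> x \<partial>lebesgue))"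

definition H1_mu :: "real^'N^'N \<Rightarrow> nat \<Rightarrow> (nat \<Rightarrow> real^'N) \<Rightarrow> (real^'N \<Rightarrow> real) \<Rightarrow> (real^'N \<Rightarrow> real^'N) \<Rightarrow> bool" where
  "H1_mu A n a f g \<longleftrightarrow> weak_gradient f g \<and>
     integrable lebesgue (\<lambda>x. (f x)\<^sup>2 * mu_dens A n a x) \<and>
     integrable lebesgue (\<lambda>x. (norm (g x))\<^sup>2 * mu_dens A n a x)"

end

theory Submission
  imports Defs
begin

text \<open>
  It suffices to prove the inequality with a single pole \<open>p = a\<^sub>i\<close> and the constant \<open>c\<^sub>o = c\<^sup>2\<close>,
  \<open>c = (N - 2)/2\<close>, and to average over \<open>i\<close>. With \<open>b = - \<nabla>\<mu>/\<mu>\<close> and the vector field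
  \<open>F = c (x - p)/|x - p|\<^sup>2 - b/2\<close> one has \<open>div F - F \<bullet> b - |F|\<^sup>2 = c\<^sup>2/|x - p|\<^sup>2 - n/2 Tr A + |b|\<^sup>2/4\<close>,
  so the claim follows by integrating \<open>|\<nabla>\<phi> + \<phi> F|\<^sup>2 \<ge> 0\<close> against \<open>\<mu>\<close>
  and integrating the mixed term by parts.

  To make sense of the integration by parts for a function that has only a weak gradient,
  \<open>\<phi>\<^sup>2\<close> is replaced by the bounded function \<open>S(\<phi>) = k \<phi>\<^sup>2 / (k + \<phi>\<^sup>2)\<close>, which satisfies \<open>S'\<^sup>2 \<le> 4 S\<close>.
  Since \<open>S\<close> and \<open>S'\<close> are bounded, the chain rule for \<open>S(\<phi>)\<close> needs only the convergence of
  mollifications in \<open>L\<^sup>1\<^sub>l\<^sub>o\<^sub>c\<close>. The field is regularised at the pole and cut off at infinity,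
  and the parameters are removed by dominated convergence and Fatou's lemma.
\<close>

text \<open>The poles interact only through the density. The drift \<open>b\<close> of the product
  of all n Gaussians has divergence n Tr A, and the part \<open>- b/2\<close> of \<open>F\<close>
  turns this into the constant n/2 Tr A. The right-hand side is thus the same for every pole, and
  averaging costs only the factor 1/n on the left.

  The condition on \<open>S'\<close> stands in for \<open>(2 * \<phi>)^2 = 4 * \<phi>^2\<close>. The
  square really expanded is that of \<open>\<nabla>\<phi> + (S'(\<phi>)/2) F\<close>; its last term
  is at most \<open>S(\<phi>)\<close> times the square of \<open>|F|\<close>, so truncation changes
  no constant.

  Weak gradients are tested only against smooth functions, but the field times density and cutoff is
  merely C^1. Hence \<open>\<phi>\<close> is mollified and the field is left alone: for a mollified
  function, integration by parts is classical. Translation and Fubini arguments compose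
  \<open>\<phi>\<close> with addition and so run on Borel representatives over
  \<open>lborel\<close>; the return to \<open>lebesgue\<close> is made once, in the chain rule.

  The left-hand side is a nonnegative integral, so its finiteness is part of the claim. Bochner
  integrals are 0 on nonintegrable functions, so integrability is carried along wherever they are
  added or compared.\<close>

section \<open>Smooth mollifiers\<close>


text \<open>The \<open>k\<close>-th derivative of \<open>exp (- 1 / (1 - t\<^sup>2))\<close> on \<open>(-1, 1)\<close> has the form
  \<open>P\<^sub>k(t) (1 - t\<^sup>2)\<^sup>-\<^sup>2\<^sup>k exp (- 1 / (1 - t\<^sup>2))\<close>; the recursion for \<open>P\<^sub>k\<close> is read off the product rule.\<close>

fun bump_poly :: "nat \<Rightarrow> real poly" where
  "bump_poly 0 = 1"
| "bump_poly (Suc k) =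
     pderiv (bump_poly k) * [:1, 0, -1:]\<^sup>2
     + smult (4 * real k) ([:0, 1:] * [:1, 0, -1:] * bump_poly k) - [:0, 2:] * bump_poly k"

definition bump :: "nat \<Rightarrow> real \<Rightarrow> real" where
  "bump k t = (if \<bar>t\<bar> < 1
     then poly (bump_poly k) t * inverse (1 - t\<^sup>2) ^ (2 * k) * exp (- inverse (1 - t\<^sup>2)) else 0)"

text \<open>\<open>u ^ n / fact n\<close> is a single term of the nonnegative series for
  \<open>exp u\<close>.\<close>

lemma power_mult_exp_minus_le:
  fixes u :: real assumes "u \<ge> 0" shows "u ^ n * exp (- u) \<le> fact n"
proof -
  have "u ^ n / fact n \<le> exp u"
    using sum_le_suminf[OF summable_exp, of "{n}" u] assms
    by (simp add: exp_def summable_exp_generic divide_inverse mult.commute)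
  then show ?thesis by (simp add: exp_minus field_simps)
qed

text \<open>With \<open>w = 1 - s\<^sup>2\<close>, the exponential absorbs the pole of order 2k and
  two further powers of \<open>w\<close>, while \<open>w\<close> is at most twice the distance from
  \<open>s\<close> to any point outside the open interval. Leaving \<open>t\<close> free treats the
  endpoints and the exterior together: the bound forces derivative 0 at each such
  \<open>t\<close>.\<close>

lemma bump_bound:
  "\<exists>C. \<forall>s t. \<bar>t\<bar> \<ge> 1 \<longrightarrow> \<bar>bump k s\<bar> \<le> C * (s - t)\<^sup>2"
proof -
  have "bounded (poly (bump_poly k) ` {-1..1})"
    by (intro compact_imp_bounded compact_continuous_image continuous_intros) auto
  then obtain M where M: "\<And>s. \<bar>s\<bar> \<le> 1 \<Longrightarrow> \<bar>poly (bump_poly k) s\<bar> \<le> M"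
    unfolding bounded_iff by force
  have M0: "M \<ge> 0" using M[of 0] by simp
  \<comment> \<open>The factorial comes from the exponential estimate with exponent 2k + 2, the
    factor 4 from squaring \<open>w \<le> 2 * \<bar>s - t\<bar>\<close>.\<close>
  define C where "C = 4 * (M * fact (2 * k + 2))"
  have "\<bar>bump k s\<bar> \<le> C * (s - t)\<^sup>2" if t: "\<bar>t\<bar> \<ge> 1" for s t
  proof (cases "\<bar>s\<bar> < 1")
    case True
    define w where "w = 1 - s\<^sup>2"
    have w: "w > 0" using True by (simp add: w_def abs_square_less_1)
    have w2: "w \<le> 2 * \<bar>s - t\<bar>"
    proof -
      have "w = (1 - \<bar>s\<bar>) * (1 + \<bar>s\<bar>)" by (simp add: w_def power2_eq_square algebra_simps)
      also have "\<dots> \<le> (1 - \<bar>s\<bar>) * 2" using True by (intro mult_left_mono) auto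
      also have "\<dots> \<le> 2 * \<bar>s - t\<bar>" using t abs_triangle_ineq2[of t s] by (simp add: abs_minus_commute)
      finally show ?thesis .
    qed
    have "\<bar>bump k s\<bar> = \<bar>poly (bump_poly k) s\<bar> * (inverse w ^ (2 * k) * exp (- inverse w))"
      using True w by (simp add: bump_def w_def abs_mult)
    also have "\<dots> \<le> M * (w\<^sup>2 * fact (2 * k + 2))"
    proof (rule mult_mono)
      have "inverse w ^ (2 * k) * exp (- inverse w)
          = w\<^sup>2 * (inverse w ^ (2 * k + 2) * exp (- inverse w))"
        using w by (simp add: power_add field_simps power2_eq_square)
      also have "\<dots> \<le> w\<^sup>2 * fact (2 * k + 2)"
        using w by (intro mult_left_mono power_mult_exp_minus_le) auto
      finally show "inverse w ^ (2 * k) * exp (- inverse w) \<le> w\<^sup>2 * fact (2 * k + 2)" .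
    qed (use M[of s] M0 True w in auto)
    also have "\<dots> = (M * fact (2 * k + 2)) * w\<^sup>2" by simp
    also have "\<dots> \<le> (M * fact (2 * k + 2)) * (2 * \<bar>s - t\<bar>)\<^sup>2"
      using w w2 M0 by (intro mult_left_mono power_mono) auto
    also have "\<dots> = C * (s - t)\<^sup>2" by (simp add: C_def power_mult_distrib)
    finally show ?thesis .
  next
    case False
    then show ?thesis using M0 by (simp add: bump_def C_def)
  qed
  then show ?thesis by blast
qed

text \<open>Serves at the two kinks of the development: the edge of the bump and the zero of the
  positive part in the cutoff.\<close>

lemma DERIV_zero_if_quadratic_bound:
  fixes f :: "real \<Rightarrow> real"
  assumes "\<And>s. \<bar>f s\<bar> \<le> C * (s - t)\<^sup>2"
  shows "(f has_real_derivative 0) (at t)"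
proof -
  have ft: "f t = 0" using assms[of t] by simp
  have "((\<lambda>s. f s / (s - t)) \<longlongrightarrow> 0) (at t)"
  proof (rule tendsto_rabs_zero_cancel, rule tendsto_sandwich[OF _ _ tendsto_const])
    have "((\<lambda>s. C * \<bar>s - t\<bar>) \<longlongrightarrow> C * \<bar>t - t\<bar>) (at t)" by (intro tendsto_intros)
    then show "((\<lambda>s. C * \<bar>s - t\<bar>) \<longlongrightarrow> 0) (at t)" by simp
    have "\<bar>f s / (s - t)\<bar> \<le> C * \<bar>s - t\<bar>" if "s \<noteq> t" for s
      using assms[of s] that
      by (simp add: abs_divide divide_le_eq power2_eq_square mult.assoc flip: abs_mult)
    then show "\<forall>\<^sub>F s in at t. \<bar>f s / (s - t)\<bar> \<le> C * \<bar>s - t\<bar>"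
      by (auto simp: eventually_at_filter)
  qed auto
  then show ?thesis by (simp add: has_field_derivative_iff ft)
qed

text \<open>Differentiation only raises the index, so this one step contains the smoothness of
  \<open>bump 0\<close>. Inside the interval it is the product rule behind \<open>bump_poly\<close>;
  elsewhere the quadratic bound gives 0.\<close>

lemma DERIV_bump: "(bump k has_real_derivative bump (Suc k) t) (at t)"
proof (cases "\<bar>t\<bar> < 1")
  case True
  define w where "w = 1 - t\<^sup>2"
  have w: "w \<noteq> 0" using True by (simp add: w_def abs_square_eq_1)
  define d where "d =
     (poly (pderiv (bump_poly k)) t * inverse w ^ (2 * k)
      + poly (bump_poly k) t * (real (2 * k) * inverse w ^ (2 * k - 1) * (2 * t * (inverse w)\<^sup>2)))
      * exp (- inverse w)
      + poly (bump_poly k) t * inverse w ^ (2 * k) * (exp (- inverse w) * - (2 * t * (inverse w)\<^sup>2))"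
  let ?g = "\<lambda>t. poly (bump_poly k) t * inverse (1 - t\<^sup>2) ^ (2 * k) * exp (- inverse (1 - t\<^sup>2))"
  have "(?g has_real_derivative d) (at t)"
    unfolding d_def w_def
    by (rule derivative_eq_intros refl poly_DERIV w[unfolded w_def] | simp add: power2_eq_square)+
  moreover have "d = bump (Suc k) t"
  proof -
    define v E V where "v = inverse w" and "E = exp (- v)" and "V = v ^ (2 * k)"
    have wv: "w * v = 1" using w by (simp add: v_def)
    \<comment> \<open>At \<open>k = 0\<close> the truncated exponent \<open>2 * k - 1\<close> is 0,
      but the prefactor vanishes, so the identity holds there too.\<close>
    have V: "real (2 * k) * v ^ (2 * k - 1) = real (2 * k) * (V * w)"
      using w by (cases k) (auto simp: V_def v_def)
    have "poly (bump_poly (Suc k)) t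
        = poly (pderiv (bump_poly k)) t * w\<^sup>2 + 4 * real k * (t * w * poly (bump_poly k) t)
          - 2 * t * poly (bump_poly k) t"
      by (simp add: w_def power2_eq_square algebra_simps)
    moreover have "bump (Suc k) t = poly (bump_poly (Suc k)) t * (V * v\<^sup>2) * E"
      using True by (simp add: bump_def w_def v_def V_def E_def power2_eq_square)
    moreover have "d = (poly (pderiv (bump_poly k)) t * V
        + poly (bump_poly k) t * (real (2 * k) * (V * w) * (2 * t * v\<^sup>2))) * E
        - poly (bump_poly k) t * V * (E * (2 * t * v\<^sup>2))"
      unfolding V[symmetric] by (simp add: d_def v_def V_def E_def)
    ultimately show ?thesis using wv by simp algebra
  qed
  ultimately have "(?g has_real_derivative bump (Suc k) t) (at t)" by simp
  then show ?thesis
    by (rule has_field_derivative_transform_within_open[of _ _ _ "{-1<..<1}"])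
       (use True in \<open>auto simp: bump_def\<close>)
next
  case False
  from bump_bound[of k] obtain C where "\<And>s. \<bar>bump k s\<bar> \<le> C * (s - t)\<^sup>2"
    using False by force
  then have "(bump k has_real_derivative 0) (at t)" by (rule DERIV_zero_if_quadratic_bound)
  then show ?thesis using False by (simp add: bump_def)
qed


text \<open>This is the partial derivative with multi-index \<open>\<kappa>\<close> of a rescaled
  product of one-dimensional bumps. A product is preferred to a radial profile because each partial
  derivative touches one factor, which keeps the family closed under \<open>pderiv_dir\<close>;
  \<open>C_infty\<close> then needs only a one-step argument.\<close>

definition cube_bump :: "real \<Rightarrow> real \<Rightarrow> ('n \<Rightarrow> nat) \<Rightarrow> real^'n \<Rightarrow> real" where
  "cube_bump c s \<kappa> x = c * (\<Prod>i\<in>UNIV. s ^ \<kappa> i * bump (\<kappa> i) (s * x $ i))"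

lemma DERIV_cube_bump:
  "((\<lambda>t. cube_bump c s \<kappa> (x + t *\<^sub>R axis j 1)) has_real_derivative
     cube_bump c s (\<kappa>(j := Suc (\<kappa> j))) x) (at 0)"
proof -
  define Q where "Q = (\<Prod>i\<in>UNIV - {j}. s ^ \<kappa> i * bump (\<kappa> i) (s * x $ i))"
  have split: "(\<Prod>i\<in>UNIV. f i) = f j * (\<Prod>i\<in>UNIV - {j}. f i)" for f :: "'a \<Rightarrow> real"
    by (simp add: prod.remove)
  have 1: "cube_bump c s \<kappa> (x + t *\<^sub>R axis j 1) =
      c * (s ^ \<kappa> j * bump (\<kappa> j) (s * (x $ j + t)) * Q)" for t
    unfolding cube_bump_def split Q_def by (auto simp: axis_def intro!: prod.cong)
  have 2: "cube_bump c s (\<kappa>(j := Suc (\<kappa> j))) x = c * (s ^ \<kappa> j * (bump (Suc (\<kappa> j)) (s * x $ j) * s) * Q)"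
    unfolding cube_bump_def split Q_def by (auto intro!: prod.cong)
  have "((\<lambda>t. bump (\<kappa> j) (s * (x $ j + t))) has_real_derivative bump (Suc (\<kappa> j)) (s * x $ j) * s) (at 0)"
    by (rule DERIV_cong, rule DERIV_chain2[OF DERIV_bump]) (auto intro!: derivative_eq_intros)
  then show ?thesis unfolding 1 2
    by (auto intro!: derivative_eq_intros)
qed

lemma continuous_on_cube_bump: "continuous_on S (cube_bump c s \<kappa>)"
proof -
  have "continuous_on UNIV (bump k)" for k
    using DERIV_bump by (meson DERIV_isCont continuous_at_imp_continuous_on)
  then have "continuous_on S (\<lambda>x. bump k (s * x $ i))" for k and i :: 'a
    by (rule continuous_on_compose2) (auto intro!: continuous_intros)
  then show ?thesis unfolding cube_bump_def by (intro continuous_intros)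
qed

lemma pderivs_cube_bump: "\<exists>\<kappa>'. pderivs js (cube_bump c s \<kappa>) = cube_bump c s \<kappa>'"
proof (induction js)
  case (Cons j js)
  then obtain \<kappa>' where "pderivs js (cube_bump c s \<kappa>) = cube_bump c s \<kappa>'" by blast
  then have "pderivs (j # js) (cube_bump c s \<kappa>) = cube_bump c s (\<kappa>'(j := Suc (\<kappa>' j)))"
    by (auto simp: pderiv_dir_def intro!: ext DERIV_imp_deriv DERIV_cube_bump)
  then show ?case by blast
qed auto

text \<open>The support is a cube of half-side \<open>1 / s\<close>; the l1 bound on the norm
  encloses it in a ball. The crude radius is harmless, since \<open>s\<close> is free.\<close>

lemma cube_bump_eq_0:
  assumes "s > 0" and "norm x > real CARD('n) / s"
  shows "cube_bump c s \<kappa> (x :: real^'n) = 0"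
proof -
  have "\<exists>i. \<bar>x $ i\<bar> \<ge> 1 / s"
  proof (rule ccontr)
    assume "\<nexists>i. \<bar>x $ i\<bar> \<ge> 1 / s"
    then have "(\<Sum>i\<in>UNIV. \<bar>x $ i\<bar>) \<le> (\<Sum>i\<in>(UNIV::'n set). 1 / s)"
      by (intro sum_mono) (auto simp: not_le less_imp_le)
    then show False using norm_le_l1_cart[of x] assms by simp
  qed
  then obtain i where "\<bar>x $ i\<bar> \<ge> 1 / s" by blast
  then have "bump (\<kappa> i) (s * x $ i) = 0"
    using \<open>s > 0\<close> by (simp add: bump_def abs_mult field_simps)
  then show ?thesis by (auto simp: cube_bump_def)
qed

lemma test_fun_cube_bump:
  assumes "s > 0" shows "test_fun (cube_bump c s \<kappa> :: real^'n \<Rightarrow> real)"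
proof -
  have "C_infty (cube_bump c s \<kappa> :: real^'n \<Rightarrow> real)"
    unfolding C_infty_def
    by (metis continuous_on_cube_bump pderivs_cube_bump DERIV_cube_bump real_differentiable_def)
  moreover have "compact (cball (0 :: real^'n) (real CARD('n) / s))" by simp
  ultimately show ?thesis
    unfolding test_fun_def using cube_bump_eq_0[OF assms] by (metis mem_cball_0 not_le)
qed

section \<open>Normalised mollifiers of arbitrarily small support\<close>

lemma integrable_compact_support:
  fixes f :: "'a::euclidean_space \<Rightarrow> real"
  assumes "continuous_on UNIV f" and "\<And>x. norm x > r \<Longrightarrow> f x = 0"
  shows "integrable lborel f"
proof -
  have "integrable lborel (\<lambda>x. indicator (cball 0 r) x *\<^sub>R f x)"
    by (rule borel_integrable_compact) (use assms in \<open>auto intro: continuous_on_subset\<close>)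
  moreover have "indicator (cball 0 r) x *\<^sub>R f x = f x" for x
    using assms(2)[of x] by (auto simp: indicator_def)
  ultimately show ?thesis by (simp only:)
qed

lemma mollifier_exists:
  assumes "\<epsilon> > 0"
  shows "\<exists>\<rho> :: real^'n \<Rightarrow> real. test_fun \<rho> \<and> (\<forall>x. \<rho> x \<ge> 0) \<and>
    (\<forall>x. norm x > \<epsilon> \<longrightarrow> \<rho> x = 0) \<and> (\<integral>x. \<rho> x \<partial>lborel) = 1"
proof -
  \<comment> \<open>Chosen so that the ball enclosing the cube has radius exactly
    \<open>\<epsilon>\<close>.\<close>
  define s where "s = real CARD('n) / \<epsilon>"
  have s: "s > 0" "real CARD('n) / s = \<epsilon>" using assms by (auto simp: s_def)
  define B :: "real^'n \<Rightarrow> real" where "B = cube_bump 1 s (\<lambda>_. 0)"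
  have B0: "B x \<ge> 0" for x by (auto simp: B_def cube_bump_def bump_def intro!: prod_nonneg)
  have Bs: "B x = 0" if "norm x > \<epsilon>" for x
    using cube_bump_eq_0[of s x] s that by (simp add: B_def)
  have Bc: "continuous_on UNIV B" by (simp add: B_def continuous_on_cube_bump)
  have Bi: "integrable lborel B" by (rule integrable_compact_support[OF Bc Bs])
  \<comment> \<open>Normalisation needs a nonzero integral: otherwise the nonempty open set where
    \<open>B\<close> differs from 0 would be negligible.\<close>
  have "(\<integral>x. B x \<partial>lborel) \<noteq> 0"
  proof
    assume "(\<integral>x. B x \<partial>lborel) = 0"
    then have ae: "AE x in lborel. B x = 0"
      using integral_nonneg_eq_0_iff_AE[OF Bi] B0 by simp
    have op: "open {x. B x \<noteq> 0}"
      using open_Collect_neq[OF Bc continuous_on_const] .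
    have "0 \<in> {x. B x \<noteq> 0}" by (simp add: B_def cube_bump_def bump_def)
    moreover have "negligible {x. B x \<noteq> 0}"
      using ae op by (auto simp: AE_iff_null negligible_iff_null_sets null_sets_completionI)
    ultimately show False using op open_not_negligible by blast
  qed
  then have pos: "(\<integral>x. B x \<partial>lborel) > 0"
    using Bochner_Integration.integral_nonneg[of lborel B] B0 by (simp add: less_le)
  define c where "c = 1 / (\<integral>x. B x \<partial>lborel)"
  have c: "c > 0" "c * (\<integral>x. B x \<partial>lborel) = 1" using pos by (auto simp: c_def)
  have eq: "cube_bump c s (\<lambda>_. 0) = (\<lambda>x. c * B x)"
    by (simp add: B_def cube_bump_def fun_eq_iff)
  have "test_fun (\<lambda>x. c * B x)" unfolding eq[symmetric] by (rule test_fun_cube_bump[OF s(1)])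
  then show ?thesis
    by (intro exI[of _ "\<lambda>x. c * B x"]) (use c B0 Bs in auto)
qed

lemma pderivs_translate:
  "pderivs js (\<lambda>y. \<psi> (y - x)) = (\<lambda>y. pderivs js \<psi> (y - x))"
  by (induction js) (auto simp: pderiv_dir_def fun_eq_iff algebra_simps)

lemma test_fun_translate:
  assumes "test_fun \<psi>" shows "test_fun (\<lambda>y. \<psi> (y - x))"
proof -
  obtain K where K: "compact K" "\<And>y. y \<notin> K \<Longrightarrow> \<psi> y = 0" and C: "C_infty \<psi>"
    using assms by (auto simp: test_fun_def)
  have "C_infty (\<lambda>y. \<psi> (y - x))"
    unfolding C_infty_def pderivs_translate
  proof (intro allI conjI)
    fix js j y
    have "continuous_on UNIV (pderivs js \<psi>)" using C by (auto simp: C_infty_def)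
    then show "continuous_on UNIV (\<lambda>y. pderivs js \<psi> (y - x))"
      by (rule continuous_on_compose2) (auto intro!: continuous_intros)
    have "(\<lambda>t. pderivs js \<psi> ((y - x) + t *\<^sub>R axis j 1)) differentiable (at 0)"
      using C unfolding C_infty_def by blast
    then show "(\<lambda>t. pderivs js \<psi> (y + t *\<^sub>R axis j 1 - x)) differentiable (at 0)"
      by (simp add: algebra_simps)
  qed
  moreover have "compact ((+) x ` K)" using K by (simp add: compact_translation)
  moreover have "\<psi> (y - x) = 0" if "y \<notin> (+) x ` K" for y
    using that by (intro K(2)) (metis add.commute diff_add_cancel image_eqI)
  ultimately show ?thesis unfolding test_fun_def by blast
qed

section \<open>Mollification of locally integrable functions\<close>


lemma
  fixes f :: "'a::euclidean_space \<Rightarrow> real"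
  assumes [measurable]: "f \<in> borel_measurable borel"
  shows integral_lborel_translate: "(\<integral>x. f (x + c) \<partial>lborel) = (\<integral>x. f x \<partial>lborel)"
    and integrable_lborel_translate: "integrable lborel (\<lambda>x. f (x + c)) \<longleftrightarrow> integrable lborel f"
proof -
  have "(\<integral>x. f x \<partial>lborel) = (\<integral>x. f x \<partial>distr lborel borel ((+) c))"
    by (simp only: lborel_distr_plus)
  also have "\<dots> = (\<integral>x. f (x + c) \<partial>lborel)" by (subst integral_distr) (auto simp: add.commute)
  finally show "(\<integral>x. f (x + c) \<partial>lborel) = (\<integral>x. f x \<partial>lborel)" by simp
  have "integrable lborel f \<longleftrightarrow> integrable (distr lborel borel ((+) c)) f"
    by (simp only: lborel_distr_plus)
  also have "\<dots> \<longleftrightarrow> integrable lborel (\<lambda>x. f (x + c))"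
    by (subst integrable_distr_eq) (auto simp: add.commute)
  finally show "integrable lborel (\<lambda>x. f (x + c)) \<longleftrightarrow> integrable lborel f" by simp
qed

lemma nn_integral_lborel_translate:
  fixes f :: "'a::euclidean_space \<Rightarrow> ennreal"
  assumes [measurable]: "f \<in> borel_measurable borel"
  shows "(\<integral>\<^sup>+x. f (x + c) \<partial>lborel) = (\<integral>\<^sup>+x. f x \<partial>lborel)"
proof -
  have "(\<integral>\<^sup>+x. f x \<partial>lborel) = (\<integral>\<^sup>+x. f x \<partial>distr lborel borel ((+) c))"
    by (simp only: lborel_distr_plus)
  also have "\<dots> = (\<integral>\<^sup>+x. f (x + c) \<partial>lborel)" by (subst nn_integral_distr) (auto simp: add.commute)
  finally show ?thesis by simp
qed

text \<open>Borel measurability is demanded because \<open>f\<close> is later composed with addition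
  on a product space, where Lebesgue measurability would not be preserved.\<close>

definition loc_int :: "('a::euclidean_space \<Rightarrow> real) \<Rightarrow> bool" where
  "loc_int f \<longleftrightarrow> f \<in> borel_measurable borel \<and>
     (\<forall>r. integrable lborel (\<lambda>x. indicator (cball 0 r) x * f x))"

lemma bounded_continuous_compact_support:
  fixes u :: "'a::euclidean_space \<Rightarrow> real"
  assumes "continuous_on UNIV u" and "\<And>x. norm x > r \<Longrightarrow> u x = 0"
  shows "\<exists>M\<ge>0. \<forall>x. \<bar>u x\<bar> \<le> M"
proof -
  have "bounded (u ` cball 0 r)"
    by (intro compact_imp_bounded compact_continuous_image) (use assms in \<open>auto intro: continuous_on_subset\<close>)
  then obtain M where "M > 0" "\<And>x. x \<in> cball 0 r \<Longrightarrow> \<bar>u x\<bar> \<le> M"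
    unfolding bounded_pos by auto
  with assms(2) have "\<bar>u x\<bar> \<le> M" for x by (cases "norm x > r") auto
  with \<open>M > 0\<close> show ?thesis by (intro exI[of _ M]) auto
qed

lemma loc_int_integrable_mult:
  fixes f :: "'a::euclidean_space \<Rightarrow> real"
  assumes "loc_int f" "continuous_on UNIV u" "\<And>x. norm x > r \<Longrightarrow> u x = 0"
  shows "integrable lborel (\<lambda>x. f x * u x)"
proof -
  have [measurable]: "f \<in> borel_measurable borel" "u \<in> borel_measurable borel"
    using assms by (auto simp: loc_int_def borel_measurable_continuous_onI)
  obtain M where M: "M \<ge> 0" "\<And>x. \<bar>u x\<bar> \<le> M"
    using bounded_continuous_compact_support[OF assms(2,3)] by blast
  show ?thesis
  proof (rule Bochner_Integration.integrable_bound)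
    show "integrable lborel (\<lambda>x. M * (indicator (cball 0 r) x * f x))"
      using assms(1) by (auto simp: loc_int_def)
    have "\<bar>f x * u x\<bar> \<le> \<bar>M * (indicator (cball 0 r) x * f x)\<bar>" for x
    proof (cases "norm x > r")
      case False
      then show ?thesis using M mult_right_mono[OF M(2), of "\<bar>f x\<bar>" x] by (simp add: abs_mult mult.commute)
    qed (use assms(3) in auto)
    then show "AE x in lborel. norm (f x * u x) \<le> norm (M * (indicator (cball 0 r) x * f x))"
      by auto
  qed simp
qed

text \<open>Directional derivatives are always given at parameter 0 but for every base point,
  matching \<open>pderiv_dir\<close>. Moving the base point recovers the derivative along the whole
  line, which the mean value estimate requires.\<close>

lemma line_DERIV:
  fixes u :: "'a::real_vector \<Rightarrow> real"
  assumes "\<And>x. ((\<lambda>t. u (x + t *\<^sub>R e)) has_real_derivative u' x) (at 0)"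
  shows "((\<lambda>t. u (x + t *\<^sub>R e)) has_real_derivative u' (x + t *\<^sub>R e)) (at t)"
proof -
  have "((\<lambda>s. u (x + (s + t) *\<^sub>R e)) has_real_derivative u' (x + t *\<^sub>R e)) (at 0)"
    using assms[of "x + t *\<^sub>R e"] by (simp add: algebra_simps)
  then show ?thesis
    using DERIV_shift[of "\<lambda>t. u (x + t *\<^sub>R e)" "u' (x + t *\<^sub>R e)" 0 t] by simp
qed

lemma line_DERIV_support:
  fixes u :: "'a::euclidean_space \<Rightarrow> real"
  assumes "\<And>x. ((\<lambda>t. u (x + t *\<^sub>R e)) has_real_derivative u' x) (at 0)"
    and "\<And>x. norm x > r \<Longrightarrow> u x = 0" and "norm x > r"
  shows "u' x = 0"
proof -
  have "open {t. norm (x + t *\<^sub>R e) > r}"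
    by (intro open_Collect_less continuous_intros)
  then have "((\<lambda>t. u (x + t *\<^sub>R e)) has_real_derivative 0) (at 0)"
    by (intro has_field_derivative_transform_within_open[OF DERIV_const[of 0]])
       (use assms in auto)
  then show ?thesis using DERIV_unique assms(1) by blast
qed

text \<open>The derivative falls on the kernel \<open>u\<close>, so local integrability of
  \<open>f\<close> suffices: by the mean value theorem the difference quotients are bounded by
  \<open>M\<close>, they live in one fixed ball, and dominated convergence applies along any
  sequence tending to 0.\<close>

lemma DERIV_integral_translate:
  fixes f :: "'a::euclidean_space \<Rightarrow> real"
  assumes f: "loc_int f" and u: "continuous_on UNIV u" and u': "continuous_on UNIV u'"
    and supp: "\<And>x. norm x > r \<Longrightarrow> u x = 0"
    and D: "\<And>x. ((\<lambda>t. u (x + t *\<^sub>R e)) has_real_derivative u' x) (at 0)"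
  shows "((\<lambda>t. \<integral>y. f y * u (y + t *\<^sub>R e) \<partial>lborel) has_real_derivative
           (\<integral>y. f y * u' y \<partial>lborel)) (at 0)"
proof -
  have [measurable]: "f \<in> borel_measurable borel" "u \<in> borel_measurable borel" "u' \<in> borel_measurable borel"
    using assms by (auto simp: loc_int_def borel_measurable_continuous_onI)
  have supp': "u' x = 0" if "norm x > r" for x
    using line_DERIV_support[OF D supp that] .
  obtain M where M: "M \<ge> 0" "\<And>x. \<bar>u' x\<bar> \<le> M"
    using bounded_continuous_compact_support[OF u' supp'] by blast
  have lip: "\<bar>u (y + t *\<^sub>R e) - u y\<bar> \<le> M * \<bar>t\<bar>" for y t
  proof -
    have "norm (u (y + t *\<^sub>R e) - u (y + 0 *\<^sub>R e)) \<le> M * norm (t - 0)"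
      by (rule field_differentiable_bound[of UNIV _ "\<lambda>s. u' (y + s *\<^sub>R e)"])
         (use line_DERIV[of u e u', OF D] M in auto)
    then show ?thesis by simp
  qed
  have int: "integrable lborel (\<lambda>y. f y * u (y + t *\<^sub>R e))" for t
  proof (rule loc_int_integrable_mult[OF f])
    show "continuous_on UNIV (\<lambda>y. u (y + t *\<^sub>R e))"
      by (rule continuous_on_compose2[OF u]) (auto intro!: continuous_intros)
    show "u (x + t *\<^sub>R e) = 0" if "norm x > r + norm (t *\<^sub>R e)" for x
      using norm_diff_ineq[of x "t *\<^sub>R e"] that by (intro supp) auto
  qed
  have "(\<lambda>i. (\<integral>y. f y * u (y + X i *\<^sub>R e) \<partial>lborel - \<integral>y. f y * u (y + 0 *\<^sub>R e) \<partial>lborel) / (X i - 0))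
          \<longlonglongrightarrow> (\<integral>y. f y * u' y \<partial>lborel)"
    if X0: "\<And>i. X i \<noteq> 0" and X: "X \<longlonglongrightarrow> 0" for X :: "nat \<Rightarrow> real"
  proof -
    obtain B where B: "B > 0" "\<And>i. \<bar>X i\<bar> \<le> B"
      using X convergent_imp_Bseq[of X] unfolding Bseq_def convergent_def by auto
    have eq: "(\<integral>y. f y * u (y + X i *\<^sub>R e) \<partial>lborel - \<integral>y. f y * u (y + 0 *\<^sub>R e) \<partial>lborel) / (X i - 0)
        = (\<integral>y. f y * ((u (y + X i *\<^sub>R e) - u y) / X i) \<partial>lborel)" for i
      using int[of "X i"] int[of 0]
      by (subst Bochner_Integration.integral_diff[symmetric]) 
         (auto simp: right_diff_distrib diff_divide_distrib)
    have "(\<lambda>i. \<integral>y. f y * ((u (y + X i *\<^sub>R e) - u y) / X i) \<partial>lborel) \<longlonglongrightarrow> (\<integral>y. f y * u' y \<partial>lborel)"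
    proof (rule integral_dominated_convergence)
      \<comment> \<open>The enlarged radius covers every translate of the support, because
        \<open>B\<close> bounds the whole sequence \<open>X\<close>.\<close>
      show "integrable lborel (\<lambda>y. M * \<bar>indicator (cball 0 (r + B * norm e)) y * f y\<bar>)"
        using f by (auto simp: loc_int_def simp del: abs_mult)
      show "AE y in lborel. (\<lambda>i. f y * ((u (y + X i *\<^sub>R e) - u y) / X i)) \<longlonglongrightarrow> f y * u' y"
      proof (intro AE_I2 tendsto_intros)
        fix y
        have "((\<lambda>t. (u (y + t *\<^sub>R e) - u y) / t) \<longlongrightarrow> u' y) (at 0)"
          using D[of y] by (simp add: has_field_derivative_iff)
        then show "(\<lambda>i. (u (y + X i *\<^sub>R e) - u y) / X i) \<longlonglongrightarrow> u' y"
          using X X0 by (auto simp: tendsto_at_iff_sequentially o_def)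
      qed
      show "AE y in lborel. norm (f y * ((u (y + X i *\<^sub>R e) - u y) / X i))
              \<le> M * \<bar>indicator (cball 0 (r + B * norm e)) y * f y\<bar>" for i
      proof (intro AE_I2)
        fix y
        show "norm (f y * ((u (y + X i *\<^sub>R e) - u y) / X i))
              \<le> M * \<bar>indicator (cball 0 (r + B * norm e)) y * f y\<bar>"
        proof (cases "norm y \<le> r + B * norm e")
          case True
          have "\<bar>(u (y + X i *\<^sub>R e) - u y) / X i\<bar> \<le> M"
            using lip[of y "X i"] X0[of i] by (simp add: abs_divide divide_le_eq)
          then have "\<bar>f y\<bar> * \<bar>(u (y + X i *\<^sub>R e) - u y) / X i\<bar> \<le> \<bar>f y\<bar> * M"
            by (rule mult_left_mono) simp
          then show ?thesis using True by (simp add: abs_mult mult.commute)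
        next
          case False
          have "norm (X i *\<^sub>R e) \<le> B * norm e" using B(2)[of i] by (simp add: mult_right_mono)
          then have "norm (y + X i *\<^sub>R e) > r" "norm y > r"
            using norm_diff_ineq[of y "X i *\<^sub>R e"] False B(1)
            by (auto simp: not_le intro: le_less_trans[rotated])
          then show ?thesis using supp M by simp
        qed
      qed
    qed simp_all
    then show ?thesis unfolding eq .
  qed
  then show ?thesis
    unfolding has_field_derivative_iff tendsto_at_iff_sequentially by (auto simp: o_def)
qed

lemma loc_int_const: "loc_int (\<lambda>_. c)"
  unfolding loc_int_def by (auto intro!: integrable_real_indicator emeasure_lborel_cball_finite)

text \<open>Taking \<open>f = 1\<close> in \<open>DERIV_integral_translate\<close>, the
  differentiated function is constant in \<open>t\<close> by translation invariance. This replaces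
  Fubini and the fundamental theorem in one coordinate.\<close>

lemma integral_line_derivative_eq_0:
  fixes u :: "'a::euclidean_space \<Rightarrow> real"
  assumes u: "continuous_on UNIV u" and u': "continuous_on UNIV u'"
    and supp: "\<And>x. norm x > r \<Longrightarrow> u x = 0"
    and D: "\<And>x. ((\<lambda>t. u (x + t *\<^sub>R e)) has_real_derivative u' x) (at 0)"
  shows "(\<integral>x. u' x \<partial>lborel) = 0"
proof -
  have [measurable]: "u \<in> borel_measurable borel"
    using u by (simp add: borel_measurable_continuous_onI)
  have "((\<lambda>t. \<integral>y. u (y + t *\<^sub>R e) \<partial>lborel) has_real_derivative (\<integral>y. u' y \<partial>lborel)) (at 0)"
    using DERIV_integral_translate[OF loc_int_const[of 1] u u' supp D] by simp
  then have "((\<lambda>t. \<integral>y. u y \<partial>lborel) has_real_derivative (\<integral>y. u' y \<partial>lborel)) (at 0)"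
    by (simp add: integral_lborel_translate)
  then show ?thesis using DERIV_unique DERIV_const by blast
qed

text \<open>The kernel is reflected with respect to the usual convolution, so that it is a translate of
  \<open>\<rho>\<close> and hence a test function without further argument.\<close>

definition mollify :: "('a::euclidean_space \<Rightarrow> real) \<Rightarrow> ('a \<Rightarrow> real) \<Rightarrow> 'a \<Rightarrow> real" where
  "mollify f \<rho> x = (\<integral>y. f y * \<rho> (y - x) \<partial>lborel)"

text \<open>The minus sign arises because the base point enters the reflected kernel as
  \<open>- x\<close>; it will cancel the minus sign in the definition of the weak gradient.\<close>

lemma DERIV_mollify:
  assumes f: "loc_int f" and \<rho>: "continuous_on UNIV \<rho>" and \<rho>': "continuous_on UNIV \<rho>'"
    and supp: "\<And>x. norm x > r \<Longrightarrow> \<rho> x = 0"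
    and D: "\<And>x. ((\<lambda>t. \<rho> (x + t *\<^sub>R e)) has_real_derivative \<rho>' x) (at 0)"
  shows "((\<lambda>t. mollify f \<rho> (x + t *\<^sub>R e)) has_real_derivative - mollify f \<rho>' x) (at 0)"
proof -
  have "((\<lambda>t. \<integral>y. f y * \<rho> ((y + t *\<^sub>R e) - x) \<partial>lborel) has_real_derivative
           (\<integral>y. f y * \<rho>' (y - x) \<partial>lborel)) (at 0)"
  proof (rule DERIV_integral_translate[OF f])
    show "continuous_on UNIV (\<lambda>y. \<rho> (y - x))" "continuous_on UNIV (\<lambda>y. \<rho>' (y - x))"
      by (auto intro!: continuous_on_compose2[OF \<rho>] continuous_on_compose2[OF \<rho>'] continuous_intros)
    show "\<rho> (y - x) = 0" if "norm y > r + norm x" for y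
      using norm_triangle_ineq2[of y x] that by (intro supp) auto
    show "((\<lambda>t. \<rho> (y + t *\<^sub>R e - x)) has_real_derivative \<rho>' (y - x)) (at 0)" for y
      using D[of "y - x"] by (simp add: algebra_simps)
  qed
  then have "((\<lambda>t. \<integral>y. f y * \<rho> ((y + (-t) *\<^sub>R e) - x) \<partial>lborel) has_real_derivative
           - (\<integral>y. f y * \<rho>' (y - x) \<partial>lborel)) (at 0)"
    using DERIV_mirror[of "\<lambda>t. \<integral>y. f y * \<rho> ((y + t *\<^sub>R e) - x) \<partial>lborel" _ 0] by simp
  then show ?thesis by (simp add: mollify_def algebra_simps)
qed

lemma continuous_on_mollify:
  fixes f :: "'a::euclidean_space \<Rightarrow> real"
  assumes f: "loc_int f" and \<rho>: "continuous_on UNIV \<rho>"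
    and supp: "\<And>x. norm x > r \<Longrightarrow> \<rho> x = 0"
  shows "continuous_on UNIV (mollify f \<rho>)"
proof (rule continuous_on_sequentiallyI)
  fix X :: "nat \<Rightarrow> 'a" and x assume X: "X \<longlonglongrightarrow> x"
  have [measurable]: "f \<in> borel_measurable borel" "\<rho> \<in> borel_measurable borel"
    using assms by (auto simp: loc_int_def borel_measurable_continuous_onI)
  obtain M where M: "M \<ge> 0" "\<And>x. \<bar>\<rho> x\<bar> \<le> M"
    using bounded_continuous_compact_support[OF \<rho> supp] by blast
  obtain B where B: "\<And>i. norm (X i) \<le> B"
    using X convergent_imp_Bseq[of X] unfolding Bseq_def convergent_def by auto
  show "(\<lambda>n. mollify f \<rho> (X n)) \<longlonglongrightarrow> mollify f \<rho> x"
    unfolding mollify_def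
  proof (rule integral_dominated_convergence)
    show "integrable lborel (\<lambda>y. M * \<bar>indicator (cball 0 (r + B)) y * f y\<bar>)"
      using f by (auto simp: loc_int_def simp del: abs_mult)
    show "AE y in lborel. (\<lambda>n. f y * \<rho> (y - X n)) \<longlonglongrightarrow> f y * \<rho> (y - x)"
      by (intro AE_I2 tendsto_intros continuous_on_tendsto_compose[OF \<rho>] X) auto
    have "\<bar>f y * \<rho> (y - X i)\<bar> \<le> M * \<bar>indicator (cball 0 (r + B)) y * f y\<bar>" for y i
    proof (cases "norm y \<le> r + B")
      case True
      then show ?thesis using mult_left_mono[OF M(2), of "\<bar>f y\<bar>" "y - X i"]
        by (simp add: abs_mult mult.commute)
    next
      case False
      then have "norm (y - X i) > r" using norm_triangle_ineq2[of y "X i"] B[of i] by linarith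
      then show ?thesis using supp M by simp
    qed
    then show "AE y in lborel. norm (f y * \<rho> (y - X i)) \<le> M * \<bar>indicator (cball 0 (r + B)) y * f y\<bar>" for i
      by auto
  qed simp_all
qed


text \<open>Induction over integrable functions. For an indicator, a Urysohn function between an
  inner closed and an outer open set differs from it only on their small difference; sums and
  dominated limits are triangle inequalities.\<close>

lemma continuous_dense_L1:
  fixes f :: "'a::euclidean_space \<Rightarrow> real"
  assumes "integrable lborel f" and "e > 0"
  shows "\<exists>g. continuous_on UNIV g \<and> integrable lborel g \<and> (\<integral>x. \<bar>f x - g x\<bar> \<partial>lborel) < e"
  using assms
proof (induction f arbitrary: e rule: integrable_induct)
  case (base A c)
  \<comment> \<open>The added 1 covers \<open>c = 0\<close> and makes
    \<open>2 * \<epsilon> * \<bar>c\<bar> < e\<close> strict.\<close>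
  define \<epsilon> where "\<epsilon> = e / (2 * \<bar>c\<bar> + 1)"
  have \<epsilon>: "\<epsilon> > 0" using base by (simp add: \<epsilon>_def)
  have A: "A \<in> sets lebesgue" "A \<in> sets borel" using base by auto
  obtain T where T: "closed T" "T \<subseteq> A" "A - T \<in> lmeasurable" "emeasure lebesgue (A - T) < ennreal \<epsilon>"
    by (rule sets_lebesgue_inner_closed[OF A(1) \<epsilon>])
  obtain U where U: "open U" "A \<subseteq> U" "U - A \<in> lmeasurable" "emeasure lebesgue (U - A) < ennreal \<epsilon>"
    by (rule sets_lebesgue_outer_open[OF A(1) \<epsilon>])
  have sets: "A \<in> sets borel" "T \<in> sets borel" "U \<in> sets borel"
    using A T U by auto
  then have [simp]: "A \<in> sets borel" "U \<in> sets borel" "A \<union> U \<in> sets borel" "U - A \<in> sets borel" "A - T \<in> sets borel" "U - T \<in> sets borel"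
    by (auto intro: sets.Diff)
  obtain h :: "'a \<Rightarrow> real" where h: "continuous_on UNIV h" "\<And>x. h x \<in> closed_segment 1 0"
      "\<And>x. x \<in> T \<Longrightarrow> h x = 1" "\<And>x. x \<in> - U \<Longrightarrow> h x = 0"
    using Urysohn[of T "- U" 1 0] T U by auto
  have h01: "0 \<le> h x" "h x \<le> 1" for x
    using h(2)[of x] by (auto simp: closed_segment_eq_real_ivl)
  have [measurable]: "h \<in> borel_measurable borel" using h by (simp add: borel_measurable_continuous_onI)
  have AT: "emeasure lborel (A - T) < ennreal \<epsilon>" and UA: "emeasure lborel (U - A) < ennreal \<epsilon>"
    using T U sets by auto
  have "emeasure lborel (U - T) \<le> emeasure lborel (U - A) + emeasure lborel (A - T)"
    by (rule order_trans[OF emeasure_mono emeasure_subadditive]) auto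
  also have "\<dots> < ennreal \<epsilon> + ennreal \<epsilon>" using AT UA by (rule add_strict_mono[rotated])
  also have "\<dots> = ennreal (2 * \<epsilon>)" using \<epsilon> by (simp flip: ennreal_plus)
  finally have UT: "emeasure lborel (U - T) < ennreal (2 * \<epsilon>)" .
  then have UT_fin: "emeasure lborel (U - T) < \<infinity>" by (rule order.strict_trans) simp
  then have mUT: "measure lborel (U - T) \<le> 2 * \<epsilon>"
    using UT \<epsilon> by (simp add: emeasure_eq_ennreal_measure less_top ennreal_less_iff less_imp_le)
  have "emeasure lborel U \<le> emeasure lborel A + emeasure lborel (U - A)"
    by (rule order_trans[OF emeasure_mono emeasure_subadditive]) auto
  also have "\<dots> < \<infinity>" using UA base by (auto simp: less_top[symmetric] intro: order.strict_trans)
  finally have U_fin: "emeasure lborel U < \<infinity>" .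
  let ?g = "\<lambda>x. h x * c"
  have gi: "integrable lborel ?g"
  proof (rule Bochner_Integration.integrable_bound)
    show "integrable lborel (\<lambda>x. indicator U x * c)"
      using U_fin by (intro integrable_mult_left integrable_real_indicator) auto
    show "AE x in lborel. norm (h x * c) \<le> norm (indicator U x * c)"
      using h01 h(4) by (auto simp: indicator_def abs_mult intro!: mult_left_le_one_le)
  qed simp
  have "(\<integral>x. \<bar>indicator A x *\<^sub>R c - ?g x\<bar> \<partial>lborel) \<le> (\<integral>x. indicator (U - T) x * \<bar>c\<bar> \<partial>lborel)"
  proof (rule integral_mono)
    show "integrable lborel (\<lambda>x. \<bar>indicator A x *\<^sub>R c - ?g x\<bar>)"
      using base gi by (intro integrable_abs Bochner_Integration.integrable_diff
          integrable_scaleR_left integrable_real_indicator) auto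
    show "integrable lborel (\<lambda>x. indicator (U - T) x * \<bar>c\<bar>)"
      using UT_fin by (intro integrable_mult_left integrable_real_indicator) auto
    show "\<bar>indicator A x *\<^sub>R c - ?g x\<bar> \<le> indicator (U - T) x * \<bar>c\<bar>" for x
    proof -
      have "\<bar>indicator A x - h x\<bar> \<le> indicator (U - T) x"
        using h01[of x] h(3)[of x] h(4)[of x] T(2) U(2) by (auto simp: indicator_def)
      then have "\<bar>indicator A x - h x\<bar> * \<bar>c\<bar> \<le> indicator (U - T) x * \<bar>c\<bar>"
        by (rule mult_right_mono) simp
      then show ?thesis by (simp add: left_diff_distrib flip: abs_mult)
    qed
  qed
  also have "\<dots> = measure lborel (U - T) * \<bar>c\<bar>" by simp
  also have "\<dots> \<le> 2 * \<epsilon> * \<bar>c\<bar>" using mUT by (intro mult_right_mono) auto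
  also have "\<dots> < e" using base by (simp add: \<epsilon>_def field_simps)
  finally show ?case using gi h(1) by (intro exI[of _ ?g]) (auto intro!: continuous_intros)
next
  case (add f1 f2)
  obtain g1 g2 where g: "continuous_on UNIV g1" "integrable lborel g1" "(\<integral>x. \<bar>f1 x - g1 x\<bar> \<partial>lborel) < e / 2"
     "continuous_on UNIV g2" "integrable lborel g2" "(\<integral>x. \<bar>f2 x - g2 x\<bar> \<partial>lborel) < e / 2"
    using add.IH[of "e / 2"] add.prems by auto
  have "(\<integral>x. \<bar>f1 x + f2 x - (g1 x + g2 x)\<bar> \<partial>lborel) \<le> (\<integral>x. \<bar>f1 x - g1 x\<bar> + \<bar>f2 x - g2 x\<bar> \<partial>lborel)"
    using add.hyps g by (intro integral_mono) auto
  also have "\<dots> = (\<integral>x. \<bar>f1 x - g1 x\<bar> \<partial>lborel) + (\<integral>x. \<bar>f2 x - g2 x\<bar> \<partial>lborel)"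
    using add.hyps g by (intro Bochner_Integration.integral_add) auto
  also have "\<dots> < e" using g by simp
  finally show ?case using g
    by (intro exI[of _ "\<lambda>x. g1 x + g2 x"]) (auto intro!: continuous_intros)
next
  case (lim f s)
  have [measurable]: "\<And>i. s i \<in> borel_measurable borel" "f \<in> borel_measurable borel"
    using lim.hyps by (auto dest: borel_measurable_integrable)
  have "(\<lambda>i. \<integral>x. \<bar>f x - s i x\<bar> \<partial>lborel) \<longlonglongrightarrow> (\<integral>x. (0::real) \<partial>(lborel :: 'a measure))"
  proof (rule integral_dominated_convergence)
    \<comment> \<open>The induction principle supplies approximants with \<open>s i\<close> bounded
      by twice \<open>f\<close>, whence the factor 3.\<close>
    show "integrable lborel (\<lambda>x. 3 * \<bar>f x\<bar>)" using lim.hyps by auto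
    show "AE x in lborel. (\<lambda>i. \<bar>f x - s i x\<bar>) \<longlonglongrightarrow> 0"
    proof (rule AE_I2)
      fix x :: 'a
      have "(\<lambda>i. \<bar>f x - s i x\<bar>) \<longlonglongrightarrow> \<bar>f x - f x\<bar>"
        using lim.hyps by (intro tendsto_intros) auto
      then show "(\<lambda>i. \<bar>f x - s i x\<bar>) \<longlonglongrightarrow> 0" by simp
    qed
    show "AE x in lborel. norm \<bar>f x - s i x\<bar> \<le> 3 * \<bar>f x\<bar>" for i
    proof (rule AE_I2)
      fix x :: 'a
      show "norm \<bar>f x - s i x\<bar> \<le> 3 * \<bar>f x\<bar>" using lim.hyps(3)[of x i] by simp
    qed
  qed simp_all
  then have "(\<lambda>i. \<integral>x. \<bar>f x - s i x\<bar> \<partial>lborel) \<longlonglongrightarrow> 0" by simp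
  then have "\<forall>\<^sub>F i in sequentially. (\<integral>x. \<bar>f x - s i x\<bar> \<partial>lborel) < e / 2"
    using order_tendstoD(2)[of _ 0 sequentially "e / 2"] lim.prems by simp
  then obtain i where i: "(\<integral>x. \<bar>f x - s i x\<bar> \<partial>lborel) < e / 2"
    using eventually_happens'[OF sequentially_bot] by blast
  obtain g where g: "continuous_on UNIV g" "integrable lborel g" "(\<integral>x. \<bar>s i x - g x\<bar> \<partial>lborel) < e / 2"
    using lim.IH[of "e / 2" i] lim.prems by auto
  have "(\<integral>x. \<bar>f x - g x\<bar> \<partial>lborel) \<le> (\<integral>x. \<bar>f x - s i x\<bar> + \<bar>s i x - g x\<bar> \<partial>lborel)"
    using lim.hyps g by (intro integral_mono) auto
  also have "\<dots> = (\<integral>x. \<bar>f x - s i x\<bar> \<partial>lborel) + (\<integral>x. \<bar>s i x - g x\<bar> \<partial>lborel)"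
    using lim.hyps g by (intro Bochner_Integration.integral_add) auto
  also have "\<dots> < e" using g i by simp
  finally show ?case using g by blast
qed

text \<open>Three-part estimate: a continuous \<open>L1\<close> approximation, twice by translation
  invariance, plus its uniform continuity on a compact ball. The nonnegative integral fits the later
  exchange of integrals directly.\<close>

lemma translation_continuous_L1:
  fixes f :: "'a::euclidean_space \<Rightarrow> real"
  assumes f: "loc_int f" and e: "e > 0" and r: "r \<ge> 0"
  shows "\<exists>d>0. \<forall>z. norm z \<le> d \<longrightarrow>
    (\<integral>\<^sup>+x. indicator (cball 0 r) x * ennreal \<bar>f (x + z) - f x\<bar> \<partial>lborel) \<le> ennreal e"
proof -
  have [measurable]: "f \<in> borel_measurable borel" using f by (auto simp: loc_int_def)
  \<comment> \<open>Radius \<open>r + 1\<close> keeps \<open>x + z\<close> inside the truncation for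
    \<open>x\<close> in the ball of radius \<open>r\<close> and \<open>z\<close> of norm at most
    1.\<close>
  define F where "F = (\<lambda>x. indicator (cball 0 (r + 1)) x * f x)"
  have F: "integrable lborel F" using f by (auto simp: loc_int_def F_def)
  obtain g where g: "continuous_on UNIV g" "integrable lborel g" "(\<integral>x. \<bar>F x - g x\<bar> \<partial>lborel) < e / 3"
    using continuous_dense_L1[OF F, of "e / 3"] e by auto
  have [measurable]: "g \<in> borel_measurable borel" "F \<in> borel_measurable borel"
    using g F by (auto dest: borel_measurable_integrable)
  define V where "V = measure lborel (cball (0::'a) r)"
  \<comment> \<open>Uniform closeness \<open>\<tau>\<close> over a ball of volume \<open>V\<close>
    costs at most \<open>e / 3\<close>; \<open>V + 1\<close> avoids dividing by zero when
    \<open>r = 0\<close>.\<close>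
  define \<tau> where "\<tau> = e / (3 * (V + 1))"
  have V: "V \<ge> 0" by (simp add: V_def)
  have \<tau>: "\<tau> > 0" "\<tau> * V \<le> e / 3" using e V by (auto simp: \<tau>_def field_simps)
  have "uniformly_continuous_on (cball 0 (r + 1)) g"
    using g(1) by (intro compact_uniformly_continuous) (auto intro: continuous_on_subset)
  then obtain d where d: "d > 0"
    "\<And>x y. x \<in> cball 0 (r + 1) \<Longrightarrow> y \<in> cball 0 (r + 1) \<Longrightarrow> dist y x < d \<Longrightarrow> dist (g y) (g x) < \<tau>"
    using \<tau>(1) unfolding uniformly_continuous_on_def by metis
  have nn: "(\<integral>\<^sup>+x. ennreal \<bar>F x - g x\<bar> \<partial>lborel) \<le> ennreal (e / 3)"
    using F g by (subst nn_integral_eq_integral) (auto intro!: ennreal_leI)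
  show ?thesis
  proof (intro exI[of _ "min 1 (d / 2)"] conjI allI impI)
    show "min 1 (d / 2) > 0" using d by simp
    fix z :: 'a assume z: "norm z \<le> min 1 (d / 2)"
    have "(\<integral>\<^sup>+x. indicator (cball 0 r) x * ennreal \<bar>f (x + z) - f x\<bar> \<partial>lborel)
        \<le> (\<integral>\<^sup>+x. (ennreal \<bar>F (x + z) - g (x + z)\<bar> + ennreal \<bar>F x - g x\<bar>)
             + ennreal \<tau> * indicator (cball 0 r) x \<partial>lborel)"
    proof (intro nn_integral_mono)
      fix x :: 'a
      show "indicator (cball 0 r) x * ennreal \<bar>f (x + z) - f x\<bar>
        \<le> (ennreal \<bar>F (x + z) - g (x + z)\<bar> + ennreal \<bar>F x - g x\<bar>) + ennreal \<tau> * indicator (cball 0 r) x"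
      proof (cases "norm x \<le> r")
        case True
        then have in1: "x \<in> cball 0 (r + 1)" "x + z \<in> cball 0 (r + 1)"
          using norm_triangle_ineq[of x z] z by auto
        have "\<bar>g (x + z) - g x\<bar> < \<tau>"
          using d(2)[OF in1] z d(1) by (auto simp: dist_norm)
        moreover have "F (x + z) = f (x + z)" "F x = f x" using in1 by (auto simp: F_def)
        ultimately have "\<bar>f (x + z) - f x\<bar> \<le> (\<bar>F (x + z) - g (x + z)\<bar> + \<bar>F x - g x\<bar>) + \<tau>"
          by linarith
        then have "ennreal \<bar>f (x + z) - f x\<bar> \<le> ennreal ((\<bar>F (x + z) - g (x + z)\<bar> + \<bar>F x - g x\<bar>) + \<tau>)"
          by (rule ennreal_leI)
        then show ?thesis using True \<tau> by simp
      qed simp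
    qed
    also have "\<dots> = (\<integral>\<^sup>+x. ennreal \<bar>F (x + z) - g (x + z)\<bar> \<partial>lborel) + (\<integral>\<^sup>+x. ennreal \<bar>F x - g x\<bar> \<partial>lborel)
         + ennreal \<tau> * emeasure lborel (cball (0::'a) r)"
    proof -
      have "(\<lambda>x::'a. ennreal \<tau> * indicator (cball 0 r) x) \<in> borel_measurable lborel"
        by (intro borel_measurable_times_ennreal borel_measurable_const borel_measurable_indicator) simp
      then show ?thesis by (subst nn_integral_add; simp add: nn_integral_add nn_integral_cmult_indicator)
    qed
    also have "(\<integral>\<^sup>+x. ennreal \<bar>F (x + z) - g (x + z)\<bar> \<partial>lborel) = (\<integral>\<^sup>+x. ennreal \<bar>F x - g x\<bar> \<partial>lborel)"
      using nn_integral_lborel_translate[of "\<lambda>x. ennreal \<bar>F x - g x\<bar>" z] by simp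
    also have "emeasure lborel (cball (0::'a) r) = ennreal V"
      unfolding V_def using emeasure_lborel_cball_finite[of "0::'a" r]
      by (simp add: emeasure_eq_ennreal_measure less_top)
    also have "(\<integral>\<^sup>+x. ennreal \<bar>F x - g x\<bar> \<partial>lborel) + (\<integral>\<^sup>+x. ennreal \<bar>F x - g x\<bar> \<partial>lborel) + ennreal \<tau> * ennreal V
       \<le> ennreal (e / 3) + ennreal (e / 3) + ennreal (e / 3)"
      using nn \<tau> V by (intro add_mono) (auto simp flip: ennreal_mult intro!: ennreal_leI)
    also have "\<dots> = ennreal e" using e by (simp flip: ennreal_plus)
    finally show "(\<integral>\<^sup>+x. indicator (cball 0 r) x * ennreal \<bar>f (x + z) - f x\<bar> \<partial>lborel) \<le> ennreal e" .
  qed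
qed

text \<open>Since \<open>\<rho>\<close> has integral 1, the error at \<open>x\<close> is the
  \<open>\<rho>\<close>-average of \<open>f (x + z) - f x\<close>. After exchanging integrals,
  translation continuity bounds the contribution of each \<open>z\<close>. The radius
  \<open>d\<close> precedes \<open>\<rho>\<close>, so the estimate is uniform over kernels.\<close>

lemma mollify_L1_approx:
  fixes f :: "'a::euclidean_space \<Rightarrow> real"
  assumes f: "loc_int f" and e: "e > 0" and r: "r \<ge> 0"
  shows "\<exists>d>0. \<forall>\<rho>. continuous_on UNIV \<rho> \<longrightarrow> (\<forall>x. \<rho> x \<ge> 0) \<longrightarrow> (\<forall>x. norm x > d \<longrightarrow> \<rho> x = 0) \<longrightarrow>
    (\<integral>x. \<rho> x \<partial>lborel) = 1 \<longrightarrow>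
    (\<integral>x. indicator (cball 0 r) x * \<bar>mollify f \<rho> x - f x\<bar> \<partial>lborel) \<le> e"
proof -
  obtain d where d: "d > 0" and trans: "\<And>z. norm z \<le> d \<Longrightarrow>
    (\<integral>\<^sup>+x. indicator (cball 0 r) x * ennreal \<bar>f (x + z) - f x\<bar> \<partial>lborel) \<le> ennreal e"
    using translation_continuous_L1[OF f e r] by blast
  have [measurable]: "f \<in> borel_measurable borel" using f by (auto simp: loc_int_def)
  have "(\<integral>x. indicator (cball 0 r) x * \<bar>mollify f \<rho> x - f x\<bar> \<partial>lborel) \<le> e"
    if \<rho>: "continuous_on UNIV \<rho>" and pos: "\<And>x. \<rho> x \<ge> 0" and supp: "\<And>x. norm x > d \<Longrightarrow> \<rho> x = 0"
      and one: "(\<integral>x. \<rho> x \<partial>lborel) = 1" for \<rho> :: "'a \<Rightarrow> real"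
  proof -
    have [measurable]: "\<rho> \<in> borel_measurable borel" using \<rho> by (simp add: borel_measurable_continuous_onI)
    have \<rho>i: "integrable lborel \<rho>" by (rule integrable_compact_support[OF \<rho> supp])
    have mc: "continuous_on UNIV (mollify f \<rho>)" by (rule continuous_on_mollify[OF f \<rho> supp])
    have [measurable]: "mollify f \<rho> \<in> borel_measurable borel"
      using mc by (simp add: borel_measurable_continuous_onI)
    have J: "(indicator (cball 0 r) :: 'a \<Rightarrow> ennreal) \<in> borel_measurable borel"
      by (intro borel_measurable_indicator borel_closed closed_cball)
    have pt: "ennreal \<bar>mollify f \<rho> x - f x\<bar> \<le> (\<integral>\<^sup>+z. ennreal (\<bar>f (x + z) - f x\<bar> * \<rho> z) \<partial>lborel)" for x
    proof -
      have "integrable lborel (\<lambda>y. f y * \<rho> (y - x))"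
      proof (rule loc_int_integrable_mult[OF f])
        show "continuous_on UNIV (\<lambda>y. \<rho> (y - x))"
          by (auto intro!: continuous_on_compose2[OF \<rho>] continuous_intros)
        show "\<rho> (y - x) = 0" if "norm y > d + norm x" for y
          using norm_triangle_ineq2[of y x] that by (intro supp) auto
      qed
      then have i1: "integrable lborel (\<lambda>z. f (z + x) * \<rho> z)"
        using integrable_lborel_translate[of "\<lambda>y. f y * \<rho> (y - x)" x] by simp
      have m1: "mollify f \<rho> x = (\<integral>z. f (z + x) * \<rho> z \<partial>lborel)"
        unfolding mollify_def
        using integral_lborel_translate[of "\<lambda>y. f y * \<rho> (y - x)" x] by simp
      have i2: "integrable lborel (\<lambda>z. f (z + x) * \<rho> z - f x * \<rho> z)"
        using i1 \<rho>i by auto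
      have "mollify f \<rho> x - f x = (\<integral>z. f (z + x) * \<rho> z - f x * \<rho> z \<partial>lborel)"
        using i1 \<rho>i one by (simp add: m1)
      then have "ennreal \<bar>mollify f \<rho> x - f x\<bar> \<le> (\<integral>\<^sup>+z. ennreal (norm (f (z + x) * \<rho> z - f x * \<rho> z)) \<partial>lborel)"
        using integral_norm_bound_ennreal[OF i2] by simp
      also have "\<dots> = (\<integral>\<^sup>+z. ennreal (\<bar>f (x + z) - f x\<bar> * \<rho> z) \<partial>lborel)"
        using pos by (intro nn_integral_cong) (simp add: add.commute abs_mult flip: left_diff_distrib)
      finally show ?thesis .
    qed
    have int: "integrable lborel (\<lambda>x. indicator (cball 0 r) x * \<bar>mollify f \<rho> x - f x\<bar>)"
    proof -
      have "integrable lborel (\<lambda>x. indicator (cball 0 r) x *\<^sub>R mollify f \<rho> x)"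
        by (rule borel_integrable_compact) (use mc in \<open>auto intro: continuous_on_subset\<close>)
      moreover have "integrable lborel (\<lambda>x. indicator (cball 0 r) x * f x)"
        using f by (auto simp: loc_int_def)
      ultimately have "integrable lborel (\<lambda>x. \<bar>indicator (cball 0 r) x * mollify f \<rho> x - indicator (cball 0 r) x * f x\<bar>)"
        by (intro integrable_abs Bochner_Integration.integrable_diff) auto
      then show ?thesis by (simp add: abs_mult flip: right_diff_distrib)
    qed
    have "ennreal (\<integral>x. indicator (cball 0 r) x * \<bar>mollify f \<rho> x - f x\<bar> \<partial>lborel)
        = (\<integral>\<^sup>+x. ennreal (indicator (cball 0 r) x * \<bar>mollify f \<rho> x - f x\<bar>) \<partial>lborel)"
      using int by (subst nn_integral_eq_integral) auto
    also have "\<dots> = (\<integral>\<^sup>+x. indicator (cball 0 r) x * ennreal \<bar>mollify f \<rho> x - f x\<bar> \<partial>lborel)"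
      by (intro nn_integral_cong) (simp add: indicator_def)
    also have "\<dots> \<le> (\<integral>\<^sup>+x. indicator (cball 0 r) x * (\<integral>\<^sup>+z. ennreal (\<bar>f (x + z) - f x\<bar> * \<rho> z) \<partial>lborel) \<partial>lborel)"
      by (intro nn_integral_mono mult_left_mono pt) auto
    also have "\<dots> = (\<integral>\<^sup>+x. \<integral>\<^sup>+z. indicator (cball 0 r) x * ennreal (\<bar>f (x + z) - f x\<bar> * \<rho> z) \<partial>lborel \<partial>lborel)"
      by (intro nn_integral_cong nn_integral_cmult[symmetric]) auto
    also have "\<dots> = (\<integral>\<^sup>+z. \<integral>\<^sup>+x. indicator (cball 0 r) x * ennreal (\<bar>f (x + z) - f x\<bar> * \<rho> z) \<partial>lborel \<partial>lborel)"
    proof (rule lborel_pair.Fubini'[symmetric])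
      have "(\<lambda>p. ennreal (\<bar>f (fst p + snd p) - f (fst p)\<bar> * \<rho> (snd p)))
          \<in> borel_measurable (borel \<Otimes>\<^sub>M borel)" by measurable
      moreover have "(\<lambda>p :: 'a \<times> 'a. indicator (cball 0 r) (fst p) :: ennreal) \<in> borel_measurable (borel \<Otimes>\<^sub>M borel)"
        by (rule measurable_compose[OF measurable_fst J])
      \<comment> \<open>The product measures over \<open>lborel\<close> and \<open>borel\<close>
        differ, but their sigma-algebras agree.\<close>
      moreover have "borel_measurable (lborel \<Otimes>\<^sub>M lborel) = (borel_measurable (borel \<Otimes>\<^sub>M borel) :: ('a \<times> 'a \<Rightarrow> ennreal) set)"
        by (intro measurable_cong_sets sets_pair_measure_cong) auto
      ultimately show "(\<lambda>(x, z). indicator (cball 0 r) x * ennreal (\<bar>f (x + z) - f x\<bar> * \<rho> z))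
          \<in> borel_measurable (lborel \<Otimes>\<^sub>M lborel)"
        by (simp add: case_prod_beta' borel_measurable_times_ennreal)
    qed
    also have "\<dots> = (\<integral>\<^sup>+z. ennreal (\<rho> z) * (\<integral>\<^sup>+x. indicator (cball 0 r) x * ennreal \<bar>f (x + z) - f x\<bar> \<partial>lborel) \<partial>lborel)"
    proof (intro nn_integral_cong)
      fix z
      have "(\<lambda>x. indicator (cball 0 r) x * ennreal \<bar>f (x + z) - f x\<bar>) \<in> borel_measurable lborel"
        using J by (intro borel_measurable_times_ennreal) auto
      then show "(\<integral>\<^sup>+x. indicator (cball 0 r) x * ennreal (\<bar>f (x + z) - f x\<bar> * \<rho> z) \<partial>lborel)
          = ennreal (\<rho> z) * (\<integral>\<^sup>+x. indicator (cball 0 r) x * ennreal \<bar>f (x + z) - f x\<bar> \<partial>lborel)"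
        using pos by (simp add: ennreal_mult mult_ac flip: nn_integral_cmult)
    qed
    also have "\<dots> \<le> (\<integral>\<^sup>+z. ennreal (\<rho> z) * ennreal e \<partial>lborel)"
    proof (intro nn_integral_mono)
      fix z
      show "ennreal (\<rho> z) * (\<integral>\<^sup>+x. indicator (cball 0 r) x * ennreal \<bar>f (x + z) - f x\<bar> \<partial>lborel)
          \<le> ennreal (\<rho> z) * ennreal e"
        using trans[of z] supp[of z] by (cases "norm z \<le> d") (auto intro: mult_left_mono)
    qed
    also have "\<dots> = ennreal e"
      using \<rho>i pos one by (simp add: nn_integral_multc nn_integral_eq_integral)
    finally show ?thesis using e by simp
  qed
  with d show ?thesis by blast
qed

section \<open>The chain rule for weak gradients\<close>


text \<open>Passes from the integrability clauses of \<open>weak_gradient\<close>, stated on the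
  completion, to a Borel representative.\<close>

lemma loc_int_if_set_integrable_lebesgue:
  fixes \<phi> :: "'a::euclidean_space \<Rightarrow> real"
  assumes f: "f \<in> borel_measurable borel" and ae: "AE x in lborel. \<phi> x = f x"
    and \<phi>: "\<And>K. compact K \<Longrightarrow> set_integrable lebesgue K \<phi>"
  shows "loc_int f"
proof -
  have "integrable lborel (\<lambda>x. indicator (cball 0 r) x * f x)" for r
  proof -
    have I: "(indicator (cball 0 r) :: 'a \<Rightarrow> real) \<in> borel_measurable borel"
      by (intro borel_measurable_indicator borel_closed closed_cball)
    have m: "(\<lambda>x. indicator (cball 0 r) x * f x) \<in> borel_measurable lborel"
      using f I by simp
    have i: "integrable lebesgue (\<lambda>x. indicator (cball 0 r) x * \<phi> x)"
      using \<phi>[of "cball 0 r"] by (simp add: set_integrable_def)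
    have "AE x in lebesgue. indicator (cball 0 r) x * \<phi> x = indicator (cball 0 r) x * f x"
      using AE_completion[OF ae] by eventually_elim simp
    then have "integrable lebesgue (\<lambda>x. indicator (cball 0 r) x * f x)"
      by (rule integrable_cong_AE_imp[OF i measurable_completion[OF m]])
    then show ?thesis using m by (simp add: integrable_completion)
  qed
  then show ?thesis using f by (auto simp: loc_int_def)
qed

lemma integral_lebesgue_eq_lborel:
  fixes f :: "'a::euclidean_space \<Rightarrow> real"
  assumes f: "f \<in> borel_measurable borel" and h: "h \<in> borel_measurable lebesgue"
    and ae: "AE x in lborel. h x = f x"
  shows "(\<integral>x. h x \<partial>lebesgue) = (\<integral>x. f x \<partial>lborel)"
proof -
  have "(\<integral>x. h x \<partial>lebesgue) = (\<integral>x. f x \<partial>lebesgue)"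
    using AE_completion[OF ae] f h by (intro integral_cong_AE) (auto intro: measurable_completion)
  then show ?thesis using f by (simp add: integral_completion)
qed

lemma test_fun_DERIV:
  assumes "test_fun \<psi>"
  shows "((\<lambda>t. \<psi> (x + t *\<^sub>R axis j 1)) has_real_derivative pderiv_dir j \<psi> x) (at 0)"
    and "continuous_on UNIV \<psi>" and "continuous_on UNIV (pderiv_dir j \<psi>)"
proof -
  have C: "continuous_on UNIV (pderivs js \<psi>)"
      "(\<lambda>t. pderivs js \<psi> (x + t *\<^sub>R axis j 1)) differentiable (at 0)" for js
    using assms by (auto simp: test_fun_def C_infty_def)
  show "continuous_on UNIV \<psi>" "continuous_on UNIV (pderiv_dir j \<psi>)"
    using C(1)[of "[]"] C(1)[of "[j]"] by auto
  show "((\<lambda>t. \<psi> (x + t *\<^sub>R axis j 1)) has_real_derivative pderiv_dir j \<psi> x) (at 0)"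
    using C(2)[of "[]"] unfolding pderiv_dir_def
    by (simp add: real_differentiable_def) (metis DERIV_imp_deriv)
qed

text \<open>For fixed \<open>x\<close> the kernel \<open>\<rho> (y - x)\<close> is itself a test
  function, and the weak identity for it is the claim after differentiation under the
  integral.\<close>

lemma weak_gradient_mollify:
  fixes f h :: "real^'n \<Rightarrow> real"
  assumes f: "loc_int f"
    and weak: "\<And>\<psi>. test_fun \<psi> \<Longrightarrow>
      (\<integral>x. f x * pderiv_dir j \<psi> x \<partial>lborel) = - (\<integral>x. h x * \<psi> x \<partial>lborel)"
    and \<rho>: "test_fun \<rho>" and supp: "\<And>x. norm x > r \<Longrightarrow> \<rho> x = 0"
  shows "((\<lambda>t. mollify f \<rho> (x + t *\<^sub>R axis j 1)) has_real_derivative mollify h \<rho> x) (at 0)"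
proof -
  have "pderiv_dir j (\<lambda>y. \<rho> (y - x)) = (\<lambda>y. pderiv_dir j \<rho> (y - x))"
    using pderivs_translate[of "[j]" \<rho> x] by simp
  then have "- mollify f (pderiv_dir j \<rho>) x = mollify h \<rho> x"
    using weak[OF test_fun_translate[OF \<rho>], of x] by (simp add: mollify_def)
  moreover have "((\<lambda>t. mollify f \<rho> (x + t *\<^sub>R axis j 1)) has_real_derivative
      - mollify f (pderiv_dir j \<rho>) x) (at 0)"
    by (rule DERIV_mollify[OF f test_fun_DERIV(2)[OF \<rho>] test_fun_DERIV(3)[OF \<rho>] supp test_fun_DERIV(1)[OF \<rho>]])
  ultimately show ?thesis by simp
qed

lemma mollify_tendsto_L1:
  fixes f :: "'a::euclidean_space \<Rightarrow> real"
  assumes f: "loc_int f" and r: "r \<ge> 0"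
    and \<rho>: "\<And>m. continuous_on UNIV (\<rho> m)" "\<And>m x. \<rho> m x \<ge> 0"
      "\<And>m x. norm x > 1 / real (Suc m) \<Longrightarrow> \<rho> m x = 0" "\<And>m. (\<integral>x. \<rho> m x \<partial>lborel) = 1"
  shows "(\<lambda>m. \<integral>x. indicator (cball 0 r) x * \<bar>mollify f (\<rho> m) x - f x\<bar> \<partial>lborel) \<longlonglongrightarrow> 0"
proof (rule LIMSEQ_I)
  fix e :: real assume "e > 0"
  then obtain d where d: "d > 0" and approx: "\<And>\<rho>. continuous_on UNIV \<rho> \<Longrightarrow> (\<forall>x. \<rho> x \<ge> 0) \<Longrightarrow>
      (\<forall>x. norm x > d \<longrightarrow> \<rho> x = 0) \<Longrightarrow> (\<integral>x. \<rho> x \<partial>lborel) = 1 \<Longrightarrow>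
      (\<integral>x. indicator (cball 0 r) x * \<bar>mollify f \<rho> x - f x\<bar> \<partial>lborel) \<le> e / 2"
    using mollify_L1_approx[OF f _ r, of "e / 2"] by auto
  obtain m0 where m0: "1 / real (Suc m0) < d" using d reals_Archimedean by (auto simp: inverse_eq_divide)
  show "\<exists>m0. \<forall>m\<ge>m0. norm ((\<integral>x. indicator (cball 0 r) x * \<bar>mollify f (\<rho> m) x - f x\<bar> \<partial>lborel) - 0) < e"
  proof (intro exI[of _ m0] allI impI)
    fix m assume "m \<ge> m0"
    then have "1 / real (Suc m) \<le> 1 / real (Suc m0)" by (intro divide_left_mono) auto
    with m0 have "\<forall>x. norm x > d \<longrightarrow> \<rho> m x = 0" using \<rho>(3)[of m] by force
    then have "(\<integral>x. indicator (cball 0 r) x * \<bar>mollify f (\<rho> m) x - f x\<bar> \<partial>lborel) \<le> e / 2"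
      using \<rho> by (intro approx) auto
    moreover have "(\<integral>x. indicator (cball 0 r) x * \<bar>mollify f (\<rho> m) x - f x\<bar> \<partial>lborel) \<ge> 0"
      by (intro Bochner_Integration.integral_nonneg) auto
    ultimately show "norm ((\<integral>x. indicator (cball 0 r) x * \<bar>mollify f (\<rho> m) x - f x\<bar> \<partial>lborel) - 0) < e"
      using \<open>e > 0\<close> by simp
  qed
qed

lemma integrable_loc_diff:
  fixes f :: "'a::euclidean_space \<Rightarrow> real"
  assumes f: "loc_int f" and g: "continuous_on UNIV g"
  shows "integrable lborel (\<lambda>x. indicator (cball 0 r) x * (g x - f x))"
proof -
  have "integrable lborel (\<lambda>x. indicator (cball 0 r) x *\<^sub>R g x)"
    by (rule borel_integrable_compact) (use g in \<open>auto intro: continuous_on_subset\<close>)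
  moreover have "integrable lborel (\<lambda>x. indicator (cball 0 r) x * f x)"
    using f by (auto simp: loc_int_def)
  ultimately show ?thesis by (simp add: right_diff_distrib)
qed

text \<open>For the mollified \<open>f\<close> this is the classical product and chain rule, so
  \<open>\<eta>\<close> needs only one continuous derivative in direction \<open>j\<close>. In the
  limit, boundedness of \<open>S\<close> and \<open>S'\<close> turns almost everywhere convergence
  of the mollified \<open>f\<close> and local \<open>L1\<close> convergence of the mollified
  \<open>h\<close> into convergence of both integrals.\<close>

lemma weak_chain_rule_lborel:
  fixes f h :: "real^'n \<Rightarrow> real"
  assumes f: "loc_int f" and h: "loc_int h"
    and weak: "\<And>\<psi>. test_fun \<psi> \<Longrightarrow>
      (\<integral>x. f x * pderiv_dir j \<psi> x \<partial>lborel) = - (\<integral>x. h x * \<psi> x \<partial>lborel)"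
    and S: "\<And>s. (S has_real_derivative S' s) (at s)" "continuous_on UNIV S'"
      "\<And>s. \<bar>S s\<bar> \<le> K" "\<And>s. \<bar>S' s\<bar> \<le> L"
    and \<eta>: "continuous_on UNIV \<eta>" "continuous_on UNIV \<eta>'" "\<And>x. norm x > r \<Longrightarrow> \<eta> x = 0"
      "\<And>x. ((\<lambda>t. \<eta> (x + t *\<^sub>R axis j 1)) has_real_derivative \<eta>' x) (at 0)"
  shows "(\<integral>x. S (f x) * \<eta>' x \<partial>lborel) = - (\<integral>x. S' (f x) * (h x * \<eta> x) \<partial>lborel)"
proof -
  \<comment> \<open>The \<open>L1\<close> convergence lemma wants a nonnegative radius, while
    \<open>r\<close> is arbitrary.\<close>
  define R where "R = max r 0"
  have R: "R \<ge> 0" "\<And>x. norm x > R \<Longrightarrow> \<eta> x = 0" using \<eta>(3) by (auto simp: R_def)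
  have R': "\<eta>' x = 0" if "norm x > R" for x
    using line_DERIV_support[of \<eta> "axis j 1" \<eta>' R, OF \<eta>(4) R(2) that] .
  have Sc: "continuous_on UNIV S"
    using S(1) by (meson DERIV_isCont continuous_at_imp_continuous_on)
  have [measurable]: "f \<in> borel_measurable borel" "h \<in> borel_measurable borel"
    "S \<in> borel_measurable borel" "S' \<in> borel_measurable borel"
    "\<eta> \<in> borel_measurable borel" "\<eta>' \<in> borel_measurable borel"
    using f h S(2) Sc \<eta> by (auto simp: loc_int_def borel_measurable_continuous_onI)
  have "\<forall>m. \<exists>\<rho> :: real^'n \<Rightarrow> real. test_fun \<rho> \<and> (\<forall>x. \<rho> x \<ge> 0) \<and>
    (\<forall>x. norm x > 1 / real (Suc m) \<longrightarrow> \<rho> x = 0) \<and> (\<integral>x. \<rho> x \<partial>lborel) = 1"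
    by (intro allI mollifier_exists) simp
  then obtain \<rho> :: "nat \<Rightarrow> real^'n \<Rightarrow> real" where \<rho>: "\<And>m. test_fun (\<rho> m)" "\<And>m x. \<rho> m x \<ge> 0"
    "\<And>m x. norm x > 1 / real (Suc m) \<Longrightarrow> \<rho> m x = 0" "\<And>m. (\<integral>x. \<rho> m x \<partial>lborel) = 1"
    by metis
  note \<rho>c = test_fun_DERIV(2)[OF \<rho>(1)]
  define F H where "F m = mollify f (\<rho> m)" and "H m = mollify h (\<rho> m)" for m
  have Fc: "continuous_on UNIV (F m)" and Hc: "continuous_on UNIV (H m)" for m
    unfolding F_def H_def
    by (rule continuous_on_mollify[OF f \<rho>c \<rho>(3)] continuous_on_mollify[OF h \<rho>c \<rho>(3)], assumption)+
  have [measurable]: "F m \<in> borel_measurable borel" "H m \<in> borel_measurable borel" for m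
    using Fc Hc by (auto simp: borel_measurable_continuous_onI)
  have DF: "((\<lambda>t. F m (x + t *\<^sub>R axis j 1)) has_real_derivative H m x) (at 0)" for m x
    unfolding F_def H_def by (rule weak_gradient_mollify[OF f weak \<rho>(1) \<rho>(3)])
  have LF: "(\<lambda>m. \<integral>x. indicator (cball 0 R) x * \<bar>F m x - f x\<bar> \<partial>lborel) \<longlonglongrightarrow> 0"
    unfolding F_def by (rule mollify_tendsto_L1[OF f R(1) \<rho>c \<rho>(2,3,4)])
  have LH: "(\<lambda>m. \<integral>x. indicator (cball 0 R) x * \<bar>H m x - h x\<bar> \<partial>lborel) \<longlonglongrightarrow> 0"
    unfolding H_def by (rule mollify_tendsto_L1[OF h R(1) \<rho>c \<rho>(2,3,4)])
  have SFc: "continuous_on UNIV (\<lambda>x. S (F m x))" "continuous_on UNIV (\<lambda>x. S' (F m x))" for m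
    by (auto intro: continuous_on_compose2[OF Sc Fc] continuous_on_compose2[OF S(2) Fc])
  have parts: "(\<integral>x. S (F m x) * \<eta>' x \<partial>lborel) = - (\<integral>x. S' (F m x) * (H m x * \<eta> x) \<partial>lborel)" for m
  proof -
    have "(\<integral>x. S (F m x) * \<eta>' x + S' (F m x) * (H m x * \<eta> x) \<partial>lborel) = 0"
    proof (rule integral_line_derivative_eq_0)
      show "continuous_on UNIV (\<lambda>x. S (F m x) * \<eta> x)"
        "continuous_on UNIV (\<lambda>x. S (F m x) * \<eta>' x + S' (F m x) * (H m x * \<eta> x))"
        by (intro continuous_intros SFc \<eta> Hc)+
      show "S (F m x) * \<eta> x = 0" if "norm x > R" for x using R(2)[OF that] by simp
      fix x
      have "((\<lambda>t. S (F m (x + t *\<^sub>R axis j 1))) has_real_derivative S' (F m x) * H m x) (at 0)"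
        using DERIV_chain2[of S _ "\<lambda>t. F m (x + t *\<^sub>R axis j 1)" 0, OF _ DF] S(1) by simp
      from DERIV_mult[OF this \<eta>(4)[of x]]
      show "((\<lambda>t. S (F m (x + t *\<^sub>R axis j 1)) * \<eta> (x + t *\<^sub>R axis j 1)) has_real_derivative
          S (F m x) * \<eta>' x + S' (F m x) * (H m x * \<eta> x)) (at 0)"
        by (simp add: algebra_simps)
    qed
    moreover have "integrable lborel (\<lambda>x. S (F m x) * \<eta>' x)"
      by (rule integrable_compact_support[of _ R]) (use R' in \<open>auto intro!: continuous_intros SFc \<eta>\<close>)
    moreover have "integrable lborel (\<lambda>x. S' (F m x) * (H m x * \<eta> x))"
      by (rule integrable_compact_support[of _ R]) (use R in \<open>auto intro!: continuous_intros SFc \<eta> Hc\<close>)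
    ultimately show ?thesis by simp
  qed
  \<comment> \<open>\<open>S\<close> and \<open>S'\<close> act pointwise, so convergence almost
    everywhere is needed; it holds along a subsequence.\<close>
  have "\<exists>q. strict_mono q \<and> (AE x in lborel. (\<lambda>m. indicator (cball 0 R) x * (F (q m) x - f x)) \<longlonglongrightarrow> 0)"
    by (rule tendsto_L1_AE_subseq[OF integrable_loc_diff[OF f Fc]]) (use LF in \<open>simp add: abs_mult\<close>)
  then obtain q where q: "strict_mono q"
      and ae: "AE x in lborel. (\<lambda>m. indicator (cball 0 R) x * (F (q m) x - f x)) \<longlonglongrightarrow> 0"
    by blast
  have ae': "AE x in lborel. norm x \<le> R \<longrightarrow> (\<lambda>m. F (q m) x) \<longlonglongrightarrow> f x"
    using ae by eventually_elim (auto simp: indicator_def LIM_zero_iff)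
  have lim1: "(\<lambda>m. \<integral>x. S (F (q m) x) * \<eta>' x \<partial>lborel) \<longlonglongrightarrow> (\<integral>x. S (f x) * \<eta>' x \<partial>lborel)"
  proof (rule integral_dominated_convergence)
    show "integrable lborel (\<lambda>x. K * \<bar>\<eta>' x\<bar>)"
      by (intro integrable_mult_right integrable_abs integrable_compact_support[of _ R] \<eta> R')
    show "AE x in lborel. (\<lambda>m. S (F (q m) x) * \<eta>' x) \<longlonglongrightarrow> S (f x) * \<eta>' x"
      using ae'
    proof eventually_elim
      case (elim x)
      show ?case
      proof (cases "norm x \<le> R")
        case True
        then show ?thesis using elim by (intro tendsto_intros continuous_on_tendsto_compose[OF Sc]) auto
      next
        case False
        then show ?thesis using R'[of x] by simp
      qed
    qed
    show "AE x in lborel. norm (S (F (q m) x) * \<eta>' x) \<le> K * \<bar>\<eta>' x\<bar>" for m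
      using S(3) by (auto simp: abs_mult intro!: mult_right_mono)
  qed simp_all
  have hi: "integrable lborel (\<lambda>x. h x * \<eta> x)" by (rule loc_int_integrable_mult[OF h \<eta>(1) R(2)])
  have lim2: "(\<lambda>m. \<integral>x. S' (F (q m) x) * (h x * \<eta> x) \<partial>lborel) \<longlonglongrightarrow> (\<integral>x. S' (f x) * (h x * \<eta> x) \<partial>lborel)"
  proof (rule integral_dominated_convergence)
    show "integrable lborel (\<lambda>x. L * \<bar>h x * \<eta> x\<bar>)"
      using hi by (intro integrable_mult_right integrable_abs)
    show "AE x in lborel. (\<lambda>m. S' (F (q m) x) * (h x * \<eta> x)) \<longlonglongrightarrow> S' (f x) * (h x * \<eta> x)"
      using ae'
    proof eventually_elim
      case (elim x)
      show ?case
      proof (cases "norm x \<le> R")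
        case True
        then show ?thesis using elim by (intro tendsto_intros continuous_on_tendsto_compose[OF S(2)]) auto
      next
        case False
        then show ?thesis using R(2)[of x] by simp
      qed
    qed
    show "AE x in lborel. norm (S' (F (q m) x) * (h x * \<eta> x)) \<le> L * \<bar>h x * \<eta> x\<bar>" for m
      unfolding real_norm_def abs_mult[of "S' _"] using S(4) by (auto intro!: mult_right_mono)
  qed simp_all
  obtain M where M: "M \<ge> 0" "\<And>x. \<bar>\<eta> x\<bar> \<le> M"
    using bounded_continuous_compact_support[OF \<eta>(1) R(2)] by blast
  have L0: "L \<ge> 0" using S(4)[of 0] by simp
  \<comment> \<open>The mollified \<open>h\<close> is split as \<open>h\<close> plus an error. The
    error vanishes in \<open>L1\<close> against bounded factors; the part with \<open>h\<close>
    itself is the dominated limit \<open>lim2\<close>.\<close>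
  have lim3: "(\<lambda>m. \<integral>x. S' (F (q m) x) * ((H (q m) x - h x) * \<eta> x) \<partial>lborel) \<longlonglongrightarrow> 0"
  proof (rule Lim_null_comparison)
    show "(\<lambda>m. L * M * (\<integral>x. indicator (cball 0 R) x * \<bar>H (q m) x - h x\<bar> \<partial>lborel)) \<longlonglongrightarrow> 0"
      using tendsto_mult_right_zero[OF LIMSEQ_subseq_LIMSEQ[OF LH q]] by (simp add: o_def)
    have "norm (\<integral>x. S' (F m x) * ((H m x - h x) * \<eta> x) \<partial>lborel)
        \<le> L * M * (\<integral>x. indicator (cball 0 R) x * \<bar>H m x - h x\<bar> \<partial>lborel)" for m
    proof -
      have i: "integrable lborel (\<lambda>x. L * M * (indicator (cball 0 R) x * \<bar>H m x - h x\<bar>))"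
        using integrable_abs[OF integrable_loc_diff[OF h Hc[of m], of R]]
        by (intro integrable_mult_right) (simp add: abs_mult)
      have b: "\<bar>S' (F m x) * ((H m x - h x) * \<eta> x)\<bar> \<le> L * M * (indicator (cball 0 R) x * \<bar>H m x - h x\<bar>)" for x
      proof (cases "norm x \<le> R")
        case True
        have "\<bar>S' (F m x)\<bar> * (\<bar>H m x - h x\<bar> * \<bar>\<eta> x\<bar>) \<le> L * (\<bar>H m x - h x\<bar> * M)"
          using S(4) M L0 by (intro mult_mono) auto
        then show ?thesis using True by (simp add: abs_mult mult_ac)
      qed (use R(2) in simp)
      have "norm (\<integral>x. S' (F m x) * ((H m x - h x) * \<eta> x) \<partial>lborel)
          \<le> (\<integral>x. L * M * (indicator (cball 0 R) x * \<bar>H m x - h x\<bar>) \<partial>lborel)"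
        by (rule order_trans[OF integral_norm_bound integral_mono[OF _ i]])
           (use b in \<open>auto intro!: Bochner_Integration.integrable_bound[OF i] order_trans[OF b] abs_ge_self\<close>)
      then show ?thesis by simp
    qed
    then show "\<forall>\<^sub>F m in sequentially. norm (\<integral>x. S' (F (q m) x) * ((H (q m) x - h x) * \<eta> x) \<partial>lborel)
        \<le> L * M * (\<integral>x. indicator (cball 0 R) x * \<bar>H (q m) x - h x\<bar> \<partial>lborel)"
      by simp
  qed
  have split: "(\<integral>x. S' (F m x) * (H m x * \<eta> x) \<partial>lborel)
     = (\<integral>x. S' (F m x) * ((H m x - h x) * \<eta> x) \<partial>lborel) + (\<integral>x. S' (F m x) * (h x * \<eta> x) \<partial>lborel)" for m
  proof -
    have i1: "integrable lborel (\<lambda>x. S' (F m x) * (h x * \<eta> x))"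
      by (rule Bochner_Integration.integrable_bound[OF integrable_mult_right[OF hi, of L]])
         (use S(4) L0 in \<open>auto simp: abs_mult intro!: mult_right_mono\<close>)
    have i2: "integrable lborel (\<lambda>x. S' (F m x) * (H m x * \<eta> x))"
      by (rule integrable_compact_support[of _ R]) (use R in \<open>auto intro!: continuous_intros SFc \<eta> Hc\<close>)
    have "integrable lborel (\<lambda>x. S' (F m x) * ((H m x - h x) * \<eta> x))"
      using Bochner_Integration.integrable_diff[OF i2 i1] by (simp add: algebra_simps)
    from Bochner_Integration.integral_add[OF this i1] show ?thesis by (simp add: algebra_simps)
  qed
  have "(\<lambda>m. \<integral>x. S (F (q m) x) * \<eta>' x \<partial>lborel) \<longlonglongrightarrow> - (0 + (\<integral>x. S' (f x) * (h x * \<eta> x) \<partial>lborel))"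
    unfolding parts split by (intro tendsto_intros lim2 lim3)
  from LIMSEQ_unique[OF lim1 this] show ?thesis by simp
qed

text \<open>Only a change of representatives: \<open>\<phi>\<close> and the \<open>j\<close>-th
  component of \<open>g\<close> agree almost everywhere with Borel functions, and none of the
  integrals notices.\<close>

lemma weak_chain_rule:
  assumes wg: "weak_gradient \<phi> g"
    and S: "\<And>s. (S has_real_derivative S' s) (at s)" "continuous_on UNIV S'"
      "\<And>s. \<bar>S s\<bar> \<le> K" "\<And>s. \<bar>S' s\<bar> \<le> L"
    and \<eta>: "continuous_on UNIV \<eta>" "continuous_on UNIV \<eta>'" "\<And>x. norm x > r \<Longrightarrow> \<eta> x = 0"
      "\<And>x. ((\<lambda>t. \<eta> (x + t *\<^sub>R axis j 1)) has_real_derivative \<eta>' x) (at 0)"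
  shows "(\<integral>x. S (\<phi> x) * \<eta>' x \<partial>lebesgue) = - (\<integral>x. S' (\<phi> x) * (g x $ j * \<eta> x) \<partial>lebesgue)"
proof -
  have m[measurable]: "\<phi> \<in> borel_measurable lebesgue" "g \<in> borel_measurable lebesgue"
    using wg by (auto simp: weak_gradient_def)
  have gj[measurable]: "(\<lambda>x. g x $ j) \<in> borel_measurable lebesgue"
    using borel_measurable_continuous_onI[of "\<lambda>v. v $ j"] m(2)
    by (auto intro!: measurable_compose[OF m(2)] continuous_intros)
  obtain f where f: "f \<in> borel_measurable lborel" "AE x in lborel. \<phi> x = f x"
    using completion_ex_borel_measurable_real[OF m(1)] by blast
  obtain h where h: "h \<in> borel_measurable lborel" "AE x in lborel. g x $ j = h x"
    using completion_ex_borel_measurable_real[OF gj] by blast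
  have [measurable]: "f \<in> borel_measurable borel" "h \<in> borel_measurable borel" using f h by auto
  have Sc: "continuous_on UNIV S"
    using S(1) by (meson DERIV_isCont continuous_at_imp_continuous_on)
  have [measurable]: "S \<in> borel_measurable borel" "S' \<in> borel_measurable borel"
    "\<eta> \<in> borel_measurable borel" "\<eta>' \<in> borel_measurable borel"
    using S(2) Sc \<eta> by (auto simp: borel_measurable_continuous_onI)
  have [measurable]: "\<eta> \<in> borel_measurable lebesgue" "\<eta>' \<in> borel_measurable lebesgue"
    by (auto intro!: measurable_completion)
  have fl: "loc_int f" and hl: "loc_int h"
    using wg f h by (auto simp: weak_gradient_def intro: loc_int_if_set_integrable_lebesgue)
  have weak: "(\<integral>x. f x * pderiv_dir j \<psi> x \<partial>lborel) = - (\<integral>x. h x * \<psi> x \<partial>lborel)" if \<psi>: "test_fun \<psi>" for \<psi>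
  proof -
    have [measurable]: "\<psi> \<in> borel_measurable borel" "pderiv_dir j \<psi> \<in> borel_measurable borel"
      using test_fun_DERIV[OF \<psi>] by (auto simp: borel_measurable_continuous_onI)
    have [measurable]: "\<psi> \<in> borel_measurable lebesgue" "pderiv_dir j \<psi> \<in> borel_measurable lebesgue"
      by (auto intro!: measurable_completion)
    have "(\<integral>x. \<phi> x * pderiv_dir j \<psi> x \<partial>lebesgue) = (\<integral>x. f x * pderiv_dir j \<psi> x \<partial>lborel)"
      by (rule integral_lebesgue_eq_lborel) (use f(2) in auto)
    moreover have "(\<integral>x. g x $ j * \<psi> x \<partial>lebesgue) = (\<integral>x. h x * \<psi> x \<partial>lborel)"
      by (rule integral_lebesgue_eq_lborel) (use h(2) in auto)
    ultimately show ?thesis using wg \<psi> by (auto simp: weak_gradient_def)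
  qed
  have "(\<integral>x. S (\<phi> x) * \<eta>' x \<partial>lebesgue) = (\<integral>x. S (f x) * \<eta>' x \<partial>lborel)"
    by (rule integral_lebesgue_eq_lborel) (use f(2) in auto)
  moreover have "(\<integral>x. S' (\<phi> x) * (g x $ j * \<eta> x) \<partial>lebesgue) = (\<integral>x. S' (f x) * (h x * \<eta> x) \<partial>lborel)"
    by (rule integral_lebesgue_eq_lborel) (use f(2) h(2) in auto)
  ultimately show ?thesis
    using weak_chain_rule_lborel[OF fl hl weak S \<eta>] by simp
qed


text \<open>Needed to add the coordinate identities: equality of Bochner integrals alone does not
  exclude the default value 0.\<close>

lemma weak_chain_rule_integrable:
  fixes S S' :: "real \<Rightarrow> real"
  assumes wg: "weak_gradient \<phi> g"
    and S: "continuous_on UNIV S" "continuous_on UNIV S'" "\<And>s. \<bar>S s\<bar> \<le> K" "\<And>s. \<bar>S' s\<bar> \<le> L"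
    and \<eta>: "continuous_on UNIV \<eta>" "continuous_on UNIV \<eta>'" "\<And>x. norm x > r \<Longrightarrow> \<eta> x = 0"
      "\<And>x. norm x > r \<Longrightarrow> \<eta>' x = 0"
  shows "integrable lebesgue (\<lambda>x. S (\<phi> x) * \<eta>' x)"
    and "integrable lebesgue (\<lambda>x. S' (\<phi> x) * (g x $ j * \<eta> x))"
proof -
  have m[measurable]: "\<phi> \<in> borel_measurable lebesgue" "g \<in> borel_measurable lebesgue"
    using wg by (auto simp: weak_gradient_def)
  have [measurable]: "(\<lambda>x. g x $ j) \<in> borel_measurable lebesgue"
    using borel_measurable_continuous_onI[of "\<lambda>v. v $ j"] m(2)
    by (auto intro!: measurable_compose[OF m(2)] continuous_intros)
  have [measurable]: "S \<in> borel_measurable borel" "S' \<in> borel_measurable borel"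
    using S by (auto simp: borel_measurable_continuous_onI)
  have [measurable]: "\<eta> \<in> borel_measurable lebesgue" "\<eta>' \<in> borel_measurable lebesgue"
    using \<eta> by (auto intro!: measurable_completion simp: borel_measurable_continuous_onI)
  have K0: "K \<ge> 0" and L0: "L \<ge> 0"  using S(3)[of 0] S(4)[of 0] by auto
  have "integrable lebesgue \<eta>'"
    using integrable_compact_support[OF \<eta>(2,4)] \<eta>(2)
    by (simp add: integrable_completion borel_measurable_continuous_onI)
  then show "integrable lebesgue (\<lambda>x. S (\<phi> x) * \<eta>' x)"
    by (rule Bochner_Integration.integrable_bound[OF integrable_mult_right[of K]])
       (use S(3) K0 in \<open>auto simp: abs_mult intro!: mult_right_mono\<close>)
  obtain M where M: "M \<ge> 0" "\<And>x. \<bar>\<eta> x\<bar> \<le> M"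
    using bounded_continuous_compact_support[OF \<eta>(1,3)] by blast
  have "integrable lebesgue (\<lambda>x. indicator (cball 0 r) x * g x $ j)"
    using wg by (auto simp: weak_gradient_def set_integrable_def)
  then show "integrable lebesgue (\<lambda>x. S' (\<phi> x) * (g x $ j * \<eta> x))"
  proof (rule Bochner_Integration.integrable_bound[OF integrable_mult_right[of "L * M"]])
    show "AE x in lebesgue. norm (S' (\<phi> x) * (g x $ j * \<eta> x))
        \<le> norm (L * M * (indicator (cball 0 r) x * g x $ j))"
    proof (rule AE_I2)
      fix x
      have "\<bar>S' (\<phi> x)\<bar> * (\<bar>g x $ j\<bar> * \<bar>\<eta> x\<bar>) \<le> L * (\<bar>g x $ j\<bar> * M)"
        using S(4) M L0 by (intro mult_mono) auto
      then show "norm (S' (\<phi> x) * (g x $ j * \<eta> x))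
        \<le> norm (L * M * (indicator (cball 0 r) x * g x $ j))"
        using \<eta>(3)[of x] L0 M(1) by (cases "norm x \<le> r") (auto simp: abs_mult mult_ac)
    qed
  qed simp
qed

section \<open>Truncation, drift and cutoff\<close>

text \<open>For nonzero \<open>s\<close> this is the reciprocal of
  \<open>1 / k + 1 / s\<^sup>2\<close>: smooth, bounded by \<open>k\<close>, and tending to
  \<open>s\<^sup>2\<close> as \<open>k\<close> grows.\<close>

definition sq_trunc :: "real \<Rightarrow> real \<Rightarrow> real" where
  "sq_trunc k s = k * s\<^sup>2 / (k + s\<^sup>2)"

definition sq_trunc' :: "real \<Rightarrow> real \<Rightarrow> real" where
  "sq_trunc' k s = 2 * k\<^sup>2 * s / (k + s\<^sup>2)\<^sup>2"

context
  fixes k :: real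
  assumes k: "k > 0"
begin

lemma sq_trunc_denom: "k + s\<^sup>2 > 0"
  using k by (simp add: add_pos_nonneg)

lemma DERIV_sq_trunc: "(sq_trunc k has_real_derivative sq_trunc' k s) (at s)"
  unfolding sq_trunc_def[abs_def] sq_trunc'_def
  using sq_trunc_denom[of s]
  by (auto intro!: derivative_eq_intros simp: field_simps power2_eq_square)

lemma continuous_on_sq_trunc': "continuous_on UNIV (sq_trunc' k)"
  unfolding sq_trunc'_def[abs_def] using sq_trunc_denom
  by (intro continuous_intros) (simp add: less_imp_neq[symmetric])

lemma sq_trunc_bounds: "0 \<le> sq_trunc k s" "sq_trunc k s \<le> s\<^sup>2" "sq_trunc k s \<le> k"
proof -
  note d = sq_trunc_denom[of s]
  show "0 \<le> sq_trunc k s" using k d by (simp add: sq_trunc_def)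
  show "sq_trunc k s \<le> k" using k d by (simp add: sq_trunc_def divide_le_eq algebra_simps)
  have "k * s\<^sup>2 \<le> s\<^sup>2 * (k + s\<^sup>2)" by (simp add: algebra_simps)
  then show "sq_trunc k s \<le> s\<^sup>2" using d by (simp add: sq_trunc_def divide_le_eq)
qed

text \<open>The quotient of the left side by the right is the cube of
  \<open>k / (k + s\<^sup>2)\<close>, which is at most 1. This is the estimate that keeps the
  completed square sharp under truncation.\<close>

lemma sq_trunc'_sq_le: "(sq_trunc' k s)\<^sup>2 \<le> 4 * sq_trunc k s"
proof -
  define d where "d = k + s\<^sup>2"
  have d: "d > 0" "k \<le> d" using sq_trunc_denom by (auto simp: d_def)
  have "(sq_trunc' k s)\<^sup>2 = 4 * (k * s\<^sup>2 / d) * (k / d) ^ 3"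
    using d by (simp add: sq_trunc'_def flip: d_def) (simp add: field_simps power2_eq_square power3_eq_cube)
  also have "\<dots> \<le> 4 * (k * s\<^sup>2 / d) * 1"
    using d k by (intro mult_left_mono power_le_one) auto
  finally show ?thesis by (simp add: sq_trunc_def d_def)
qed

lemma sq_trunc'_bound: "\<bar>sq_trunc' k s\<bar> \<le> 2 * sqrt k"
proof -
  have "\<bar>sq_trunc' k s\<bar> \<le> sqrt (4 * k)"
    using sq_trunc'_sq_le[of s] sq_trunc_bounds(3)[of s] by (intro real_le_rsqrt) simp
  then show ?thesis by (simp add: real_sqrt_mult)
qed

end

lemma trace_pos_def_nonneg:
  fixes A :: "real^'n^'n"
  assumes "pos_def_sym A" shows "trace A \<ge> 0"
proof -
  have "A $ i $ i \<ge> 0" for i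
  proof -
    have "axis i 1 \<bullet> (A *v axis i (1::real)) > 0" using assms by (simp add: pos_def_sym_def axis_eq_0_iff)
    then show ?thesis by (simp add: matrix_vector_mult_basis column_def inner_axis')
  qed
  then show ?thesis by (simp add: trace_def sum_nonneg)
qed

section \<open>The Gaussian density and its logarithmic gradient\<close>

lemma mu_dens_nonneg: "mu_dens A n a x \<ge> 0"
  by (auto simp: mu_dens_def gauss_exp_def intro!: divide_nonneg_nonneg Bochner_Integration.integral_nonneg)

lemma continuous_on_mu_dens: "continuous_on S (mu_dens A n a)"
  unfolding mu_dens_def[abs_def] gauss_exp_def[abs_def]
  unfolding divide_inverse
  by (intro continuous_intros bounded_linear.continuous_on[OF matrix_vector_mul_bounded_linear])

definition drift :: "real^'n^'n \<Rightarrow> nat \<Rightarrow> (nat \<Rightarrow> real^'n) \<Rightarrow> real^'n \<Rightarrow> real^'n" where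
  "drift A n a x = (\<Sum>i=1..n. A *v (x - a i))"

text \<open>The drift is affine with linear part n A. Both its linear growth and its divergence n Tr
  A are read off from this.\<close>

lemma drift_add: "drift A n a (x + y) = drift A n a x + real n *\<^sub>R (A *v y)"
proof -
  have "drift A n a (x + y) = (\<Sum>i=1..n. A *v (x - a i) + A *v y)"
    unfolding drift_def matrix_vector_right_distrib[symmetric] by (simp add: add_diff_eq diff_add_eq)
  then show ?thesis by (simp add: sum.distrib drift_def sum_constant_scaleR del: sum_constant)
qed

lemma continuous_on_drift: "continuous_on S (drift A n a)"
  unfolding drift_def[abs_def]
  by (intro continuous_intros bounded_linear.continuous_on[OF matrix_vector_mul_bounded_linear])

lemma drift_bound: "\<exists>C1 C2. C1 \<ge> 0 \<and> C2 \<ge> 0 \<and> (\<forall>x. norm (drift A n a x) \<le> C1 + C2 * norm (x - p))"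
proof -
  obtain B where B: "B > 0" "\<And>y. norm (A *v y) \<le> norm y * B"
    using bounded_linear.pos_bounded[OF matrix_vector_mul_bounded_linear[of A]] by auto
  have "norm (drift A n a x) \<le> norm (drift A n a p) + (real n * B) * norm (x - p)" for x
  proof -
    have "drift A n a x = drift A n a p + real n *\<^sub>R (A *v (x - p))"
      using drift_add[of A n a p "x - p"] by simp
    then have "norm (drift A n a x) \<le> norm (drift A n a p) + real n * norm (A *v (x - p))"
      using norm_triangle_ineq[of "drift A n a p" "real n *\<^sub>R (A *v (x - p))"] by simp
    also have "real n * norm (A *v (x - p)) \<le> real n * (norm (x - p) * B)"
      by (intro mult_left_mono B) simp
    finally show ?thesis by (simp add: mult_ac)
  qed
  then show ?thesis using B(1)
    by (intro exI[of _ "norm (drift A n a p)"] exI[of _ "real n * B"]) auto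
qed

lemma DERIV_drift:
  "((\<lambda>t. drift A n a (x + t *\<^sub>R axis j 1) $ j) has_real_derivative real n * A $ j $ j) (at 0)"
proof -
  have "drift A n a (x + t *\<^sub>R axis j 1) $ j = drift A n a x $ j + real n * (t * A $ j $ j)" for t
    by (simp add: drift_add matrix_vector_mult_scaleR matrix_vector_mult_basis column_def)
  then show ?thesis by (auto intro!: derivative_eq_intros)
qed

text \<open>Symmetry of \<open>A\<close> merges the two cross terms of each quadratic form into one
  doubled term, which the factor 1/2 in the exponent cancels.\<close>

lemma DERIV_mu_dens:
  assumes "transpose A = A"
  shows "((\<lambda>t. mu_dens A n a (x + t *\<^sub>R axis j 1)) has_real_derivative
           - (mu_dens A n a x * drift A n a x $ j)) (at 0)"
proof -
  let ?e = "axis j (1::real)"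
  have sym: "(A *v u) \<bullet> v = u \<bullet> (A *v v)" for u v
    using dot_lmul_matrix[of u A v] assms by (metis transpose_matrix_vector)
  have quad: "(A *v (x + t *\<^sub>R ?e - a i)) \<bullet> (x + t *\<^sub>R ?e - a i)
      = (A *v (x - a i)) \<bullet> (x - a i) + t * (2 * (A *v (x - a i)) $ j) + t\<^sup>2 * ((A *v ?e) \<bullet> ?e)" for t i
  proof -
    define y where "y = x - a i"
    have 1: "x + t *\<^sub>R ?e - a i = y + t *\<^sub>R ?e" by (simp add: y_def)
    have 2: "(A *v ?e) \<bullet> y = (A *v y) $ j"
      using sym[of ?e y] by (simp add: inner_axis')
    show ?thesis unfolding 1 y_def[symmetric]
      by (simp add: matrix_vector_right_distrib matrix_vector_mult_scaleR inner_add_left inner_add_right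
          2 power2_eq_square inner_axis distrib_left)
  qed
  define E where "E = (\<integral>y. gauss_exp A n a y \<partial>lebesgue)"
  have "((\<lambda>t. \<Sum>i=1..n. (A *v (x + t *\<^sub>R ?e - a i)) \<bullet> (x + t *\<^sub>R ?e - a i)) has_real_derivative
     (\<Sum>i=1..n. 2 * (A *v (x - a i)) $ j)) (at 0)"
  proof (rule DERIV_sum)
    show "((\<lambda>t. (A *v (x + t *\<^sub>R ?e - a i)) \<bullet> (x + t *\<^sub>R ?e - a i)) has_real_derivative
        2 * (A *v (x - a i)) $ j) (at 0)" for i
      unfolding quad by (auto intro!: derivative_eq_intros)
  qed
  then have "((\<lambda>t. mu_dens A n a (x + t *\<^sub>R ?e)) has_real_derivative
     exp (- (1/2) * (\<Sum>i=1..n. (A *v (x + 0 *\<^sub>R ?e - a i)) \<bullet> (x + 0 *\<^sub>R ?e - a i)))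
      * (- (1/2) * (\<Sum>i=1..n. 2 * (A *v (x - a i)) $ j)) / E) (at 0)"
    unfolding mu_dens_def gauss_exp_def[of _ _ _ "_ + _"] E_def[symmetric]
    by (intro DERIV_cdivide DERIV_fun_exp DERIV_cmult)
  then show ?thesis
    by (simp add: mu_dens_def gauss_exp_def E_def drift_def sum_distrib_left[symmetric])
qed

text \<open>Squaring the positive part makes it C^1, which is all that the chain rule asks of its
  test function. The gradient is of order \<open>1 / R\<close> on the support, enough to balance a
  field of linear growth.\<close>

definition cutoff :: "real \<Rightarrow> 'a::real_normed_vector \<Rightarrow> real" where
  "cutoff R y = (max 0 (1 - (norm y)\<^sup>2 / R\<^sup>2))\<^sup>2"

definition cutoff_grad :: "real \<Rightarrow> 'a::real_normed_vector \<Rightarrow> 'a" where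
  "cutoff_grad R y = (- 4 * max 0 (1 - (norm y)\<^sup>2 / R\<^sup>2) / R\<^sup>2) *\<^sub>R y"

lemma DERIV_max0_sq: "((\<lambda>s. (max 0 s)\<^sup>2) has_real_derivative 2 * max 0 s) (at (s::real))"
proof -
  consider "s < 0" | "s > 0" | "s = 0" by linarith
  then show ?thesis
  proof cases
    case 1
    then have "((\<lambda>s. (max 0 s)\<^sup>2) has_real_derivative 0) (at s)"
      by (intro has_field_derivative_transform_within_open[OF DERIV_const[of 0], where S = "{..<0}"]) auto
    then show ?thesis using 1 by simp
  next
    case 2
    have "((\<lambda>s. s\<^sup>2) has_real_derivative 2 * s) (at s)" by (auto intro!: derivative_eq_intros)
    then have "((\<lambda>s. (max 0 s)\<^sup>2) has_real_derivative 2 * s) (at s)"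
      by (rule has_field_derivative_transform_within_open[of _ _ _ "{0<..}"]) (use 2 in auto)
    then show ?thesis using 2 by simp
  next
    case 3
    have "((\<lambda>s::real. (max 0 s)\<^sup>2) has_real_derivative 0) (at 0)"
      by (rule DERIV_zero_if_quadratic_bound[of _ 1]) (auto simp: max_def power_mono)
    then show ?thesis using 3 by simp
  qed
qed

lemma norm_sq_add_axis:
  fixes y :: "real^'n"
  shows "(norm (y + t *\<^sub>R axis j 1))\<^sup>2 = (norm y)\<^sup>2 + t * (2 * y $ j) + t\<^sup>2"
  unfolding power2_norm_eq_inner
  by (simp add: inner_add_left inner_add_right inner_axis inner_axis' power2_eq_square algebra_simps)

lemma DERIV_norm_sq:
  fixes y :: "real^'n"
  shows "((\<lambda>t. (norm (y + t *\<^sub>R axis j 1))\<^sup>2) has_real_derivative 2 * y $ j) (at 0)"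
  unfolding norm_sq_add_axis by (auto intro!: derivative_eq_intros)

lemma DERIV_cutoff:
  fixes y :: "real^'n"
  shows "((\<lambda>t. cutoff R (y + t *\<^sub>R axis j 1)) has_real_derivative cutoff_grad R y $ j) (at 0)"
proof -
  have "((\<lambda>t. 1 - (norm (y + t *\<^sub>R axis j 1))\<^sup>2 / R\<^sup>2) has_real_derivative 0 - 2 * y $ j / R\<^sup>2) (at 0)"
    by (intro DERIV_diff DERIV_const DERIV_cdivide DERIV_norm_sq)
  from DERIV_chain2[OF DERIV_max0_sq this] show ?thesis
    unfolding cutoff_def cutoff_grad_def by (simp add: algebra_simps)
qed

lemma cutoff_bounds: "0 \<le> cutoff R y" "cutoff R y \<le> 1"
  by (auto simp: cutoff_def max_def power_le_one)

lemma cutoff_eq_0: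
  assumes "R > 0" "norm y \<ge> R" shows "cutoff R y = 0" "cutoff_grad R y = 0"
proof -
  have "(norm y)\<^sup>2 / R\<^sup>2 \<ge> 1" using assms by (simp add: power_mono)
  then show "cutoff R y = 0" "cutoff_grad R y = 0" by (auto simp: cutoff_def cutoff_grad_def max_def)
qed

lemma norm_cutoff_grad_le:
  "norm (cutoff_grad R y) \<le> 4 * norm y / R\<^sup>2"
proof -
  have "max 0 (1 - (norm y)\<^sup>2 / R\<^sup>2) \<le> 1" by auto
  then have "4 * max 0 (1 - (norm y)\<^sup>2 / R\<^sup>2) * norm y / R\<^sup>2 \<le> 4 * 1 * norm y / R\<^sup>2"
    by (intro divide_right_mono mult_right_mono mult_left_mono) auto
  then show ?thesis by (simp add: cutoff_grad_def)
qed

lemma continuous_on_cutoff: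
  "continuous_on S (cutoff R)" "continuous_on S (cutoff_grad R)"
  unfolding cutoff_def[abs_def] cutoff_grad_def[abs_def] divide_inverse
  by (intro continuous_intros)+

lemma cutoff_tendsto: "(\<lambda>m. cutoff (real (Suc m)) y) \<longlonglongrightarrow> 1"
proof -
  have "(\<lambda>m. inverse (real (Suc m))) \<longlonglongrightarrow> 0" by (rule LIMSEQ_inverse_real_of_nat)
  then have "(\<lambda>m. (max 0 (1 - (norm y)\<^sup>2 * (inverse (real (Suc m)))\<^sup>2))\<^sup>2)
      \<longlonglongrightarrow> (max 0 (1 - (norm y)\<^sup>2 * 0\<^sup>2))\<^sup>2"
    by (intro tendsto_intros)
  then show ?thesis by (simp add: cutoff_def divide_inverse power_inverse del: of_nat_Suc)
qed

section \<open>The weighted Hardy inequality\<close>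


definition hardy_field :: "real^'n^'n \<Rightarrow> nat \<Rightarrow> (nat \<Rightarrow> real^'n) \<Rightarrow> real^'n \<Rightarrow> real \<Rightarrow> real^'n \<Rightarrow> real^'n" where
  "hardy_field A n a p \<delta> x =
     ((real CARD('n) - 2) / 2 / ((norm (x - p))\<^sup>2 + \<delta>)) *\<^sub>R (x - p) - (1/2) *\<^sub>R drift A n a x"

text \<open>Only the diagonal entries of the Jacobian are needed; their sum over \<open>j\<close> is
  the divergence.\<close>

definition hardy_field_deriv :: "real^'n^'n \<Rightarrow> nat \<Rightarrow> real^'n \<Rightarrow> real \<Rightarrow> 'n \<Rightarrow> real^'n \<Rightarrow> real" where
  "hardy_field_deriv A n p \<delta> j x =
     (real CARD('n) - 2) / 2 * (1 / ((norm (x - p))\<^sup>2 + \<delta>)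
        - 2 * ((x - p) $ j)\<^sup>2 / ((norm (x - p))\<^sup>2 + \<delta>)\<^sup>2) - real n / 2 * A $ j $ j"

context
  fixes A :: "real^'n^'n" and n :: nat and a :: "nat \<Rightarrow> real^'n" and p :: "real^'n" and \<delta> :: real
  assumes \<delta>: "\<delta> > 0"
begin

lemma hardy_denom: "(norm (x - p))\<^sup>2 + \<delta> > 0"
  using \<delta> by (simp add: add_nonneg_pos)

lemma DERIV_hardy_field:
  "((\<lambda>t. hardy_field A n a p \<delta> (x + t *\<^sub>R axis j 1) $ j) has_real_derivative
     hardy_field_deriv A n p \<delta> j x) (at 0)"
proof -
  define c where "c = (real CARD('n) - 2) / 2"
  define y q where "y = x - p" and "q = (norm y)\<^sup>2 + \<delta>"
  have q: "q > 0" using hardy_denom by (simp add: q_def y_def)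
  have xy: "x + t *\<^sub>R axis j 1 - p = y + t *\<^sub>R axis j 1" for t by (simp add: y_def)
  have "((\<lambda>t. ((norm (y + t *\<^sub>R axis j 1))\<^sup>2 + \<delta>)) has_real_derivative 2 * y $ j) (at 0)"
    by (rule DERIV_cong[OF DERIV_add[OF DERIV_norm_sq DERIV_const]]) simp
  moreover have "((\<lambda>t. c * (y $ j + t)) has_real_derivative c) (at 0)"
    by (auto intro!: derivative_eq_intros)
  ultimately have "((\<lambda>t. c * (y $ j + t) / ((norm (y + t *\<^sub>R axis j 1))\<^sup>2 + \<delta>)) has_real_derivative
      (c * q - c * y $ j * (2 * y $ j)) / (q * q)) (at 0)"
    using DERIV_divide[of "\<lambda>t. c * (y $ j + t)" c 0 UNIV
        "\<lambda>t. (norm (y + t *\<^sub>R axis j 1))\<^sup>2 + \<delta>" "2 * y $ j"] q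
    by (simp add: q_def)
  from DERIV_diff[OF this DERIV_cmult[OF DERIV_drift[of A n a x j], of "1/2"]]
  have "((\<lambda>t. c * (y $ j + t) / ((norm (y + t *\<^sub>R axis j 1))\<^sup>2 + \<delta>) - 1/2 * drift A n a (x + t *\<^sub>R axis j 1) $ j)
      has_real_derivative (c * q - c * y $ j * (2 * y $ j)) / (q * q) - 1/2 * (real n * A $ j $ j)) (at 0)" .
  moreover have "(c * q - c * y $ j * (2 * y $ j)) / (q * q) - 1/2 * (real n * A $ j $ j)
      = hardy_field_deriv A n p \<delta> j x"
    unfolding hardy_field_deriv_def y_def[symmetric] q_def[symmetric] c_def[symmetric] using q
    by (simp add: field_simps power2_eq_square)
  moreover have "hardy_field A n a p \<delta> (x + t *\<^sub>R axis j 1) $ j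
     = c * (y $ j + t) / ((norm (y + t *\<^sub>R axis j 1))\<^sup>2 + \<delta>) - 1/2 * drift A n a (x + t *\<^sub>R axis j 1) $ j" for t
    unfolding hardy_field_def xy c_def[symmetric] by simp
  ultimately show ?thesis by simp
qed

lemma continuous_on_hardy_field: "continuous_on S (hardy_field A n a p \<delta>)"
  unfolding hardy_field_def[abs_def] using hardy_denom
  by (intro continuous_intros continuous_on_drift) (simp add: less_imp_neq[symmetric])

lemma continuous_on_hardy_field_deriv: "continuous_on S (hardy_field_deriv A n p \<delta> j)"
  unfolding hardy_field_deriv_def[abs_def] using hardy_denom
  by (intro continuous_intros) (auto simp: less_imp_neq[symmetric])

text \<open>Writing \<open>h = |x - p|\<^sup>-\<^sup>c \<mu>\<^sup>-\<^sup>1\<^sup>/\<^sup>2\<close> for the formal extremal of the inequality with pole \<open>p\<close>,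
  the field is \<open>- \<nabla>h / h\<close> (regularised by \<open>\<delta>\<close>), which makes the mixed terms cancel here.\<close>

lemma hardy_field_div_ge:
  assumes "CARD('n) \<ge> 2"
  shows "(\<Sum>j\<in>UNIV. hardy_field_deriv A n p \<delta> j x) - hardy_field A n a p \<delta> x \<bullet> drift A n a x
      - (norm (hardy_field A n a p \<delta> x))\<^sup>2
    \<ge> ((real CARD('n) - 2) / 2)\<^sup>2 / ((norm (x - p))\<^sup>2 + \<delta>) - real n / 2 * trace A"
proof -
  define c y q b where "c = (real CARD('n) - 2) / 2" and "y = x - p" and "q = (norm y)\<^sup>2 + \<delta>"
    and "b = drift A n a x"
  have q: "q > 0" "(norm y)\<^sup>2 \<le> q" using hardy_denom \<delta> by (auto simp: q_def y_def)
  have "2 * c = real CARD('n) - 2" by (simp add: c_def)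
  then have c: "c \<ge> 0" "real CARD('n) = 2 * c + 2" using assms by linarith+
  have F: "hardy_field A n a p \<delta> x = (c / q) *\<^sub>R y - (1/2) *\<^sub>R b"
    by (simp add: hardy_field_def c_def y_def q_def b_def)
  have "(\<Sum>j\<in>UNIV. hardy_field_deriv A n p \<delta> j x)
      = (\<Sum>j\<in>UNIV. c / q - (2 * c / q\<^sup>2) * (y $ j)\<^sup>2 - real n / 2 * A $ j $ j)"
    by (intro sum.cong) (auto simp: hardy_field_deriv_def c_def y_def q_def algebra_simps)
  also have "\<dots> = real CARD('n) * (c / q) - (2 * c / q\<^sup>2) * (\<Sum>j\<in>UNIV. (y $ j)\<^sup>2) - real n / 2 * trace A"
    by (simp add: sum_subtractf sum_distrib_left trace_def)
  also have "(\<Sum>j\<in>UNIV. (y $ j)\<^sup>2) = (norm y)\<^sup>2"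
    unfolding power2_norm_eq_inner inner_vec_def by (simp add: power2_eq_square)
  finally have div: "(\<Sum>j\<in>UNIV. hardy_field_deriv A n p \<delta> j x)
      = (2 * c + 2) * (c / q) - (2 * c / q\<^sup>2) * (norm y)\<^sup>2 - real n / 2 * trace A" by (simp add: c(2))
  have Fb: "((c / q) *\<^sub>R y - (1/2) *\<^sub>R b) \<bullet> b = (c / q) * (y \<bullet> b) - (1/2) * (b \<bullet> b)"
    by (simp add: inner_diff_left)
  have FF: "(norm ((c / q) *\<^sub>R y - (1/2) *\<^sub>R b))\<^sup>2
      = (c / q)\<^sup>2 * (norm y)\<^sup>2 - (c / q) * (y \<bullet> b) + (1/4) * (b \<bullet> b)"
    unfolding power2_norm_eq_inner
    by (simp add: inner_diff_left inner_diff_right inner_commute power2_eq_square)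
  \<comment> \<open>The only loss from regularising is the squared norm of \<open>y\<close> being at
    most \<open>q\<close>. It goes the right way because \<open>c \<ge> 0\<close>; for
    \<open>\<delta> = 0\<close> it would be an equality. The other discarded term is
    \<open>b \<bullet> b / 4\<close>.\<close>
  have "(2 * c + c\<^sup>2) / q\<^sup>2 * (norm y)\<^sup>2 \<le> (2 * c + c\<^sup>2) / q\<^sup>2 * q"
    using q c by (intro mult_left_mono) auto
  also have "\<dots> = (2 * c + c\<^sup>2) / q" using q by (simp add: power2_eq_square)
  finally have key: "(2 * c + c\<^sup>2) / q\<^sup>2 * (norm y)\<^sup>2 \<le> (2 * c + c\<^sup>2) / q" .
  have "(2 * c + 2) * (c / q) - (2 * c + c\<^sup>2) / q = c\<^sup>2 / q"
    using q by (simp add: field_simps power2_eq_square)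
  moreover have "(2 * c / q\<^sup>2) * (norm y)\<^sup>2 + (c / q)\<^sup>2 * (norm y)\<^sup>2 = (2 * c + c\<^sup>2) / q\<^sup>2 * (norm y)\<^sup>2"
    by (simp add: power_divide add_divide_distrib distrib_right)
  moreover have "b \<bullet> b \<ge> 0" by simp
  ultimately show ?thesis
    unfolding F b_def[symmetric] div Fb FF c_def[symmetric] y_def[symmetric] q_def[symmetric]
    using key by linarith
qed

lemma hardy_field_bound: "\<exists>C\<ge>0. \<forall>x. norm (hardy_field A n a p \<delta> x) \<le> C * (1 + norm (x - p))"
proof -
  obtain C1 C2 where C: "C1 \<ge> 0" "C2 \<ge> 0" "\<And>x. norm (drift A n a x) \<le> C1 + C2 * norm (x - p)"
    using drift_bound by blast
  let ?c = "\<bar>(real CARD('n) - 2) / 2\<bar>"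
  have "norm (hardy_field A n a p \<delta> x) \<le> (?c / \<delta> + C1 + C2) * (1 + norm (x - p))" for x
  proof -
    have "norm (hardy_field A n a p \<delta> x) \<le> ?c / ((norm (x - p))\<^sup>2 + \<delta>) * norm (x - p) + 1/2 * norm (drift A n a x)"
      unfolding hardy_field_def using hardy_denom[of x]
      by (intro order_trans[OF norm_triangle_ineq4]) (simp add: abs_divide)
    also have "\<dots> \<le> ?c / \<delta> * norm (x - p) + 1 * (C1 + C2 * norm (x - p))"
      using hardy_denom[of x] \<delta> C by (intro add_mono mult_mono divide_left_mono) auto
    also have "\<dots> \<le> (?c / \<delta> + C1 + C2) * (1 + norm (x - p))"
    proof -
      have aux: "K * r + 1 * (C1 + C2 * r) \<le> (K + C1 + C2) * (1 + r)" if "K \<ge> 0" "r \<ge> 0" for K r :: real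
        using that C by (simp add: algebra_simps)
      show ?thesis by (rule aux) (use \<delta> in auto)
    qed
    finally show ?thesis .
  qed
  then show ?thesis using C \<delta> by (intro exI[of _ "?c / \<delta> + C1 + C2"]) auto
qed

end

text \<open>The completed square integrated with \<open>k\<close> and \<open>\<delta>\<close> fixed;
  only the cutoff radius is sent to infinity here. Every integrand is dominated by multiples of
  \<open>\<phi>\<close> squared and \<open>|g|\<close> squared against the density, since
  \<open>S \<le> (\<phi> x)\<^sup>2\<close> and the regularised potential is bounded.\<close>

lemma hardy_truncated:
  fixes A :: "real^'n^'n"
  assumes N: "CARD('n) \<ge> 2" and A: "pos_def_sym A" and H: "H1_mu A n a \<phi> g"
    and k: "k > 0" and \<delta>: "\<delta> > 0"
  shows "integrable lebesgue (\<lambda>x. ((real CARD('n) - 2) / 2)\<^sup>2 / ((norm (x - p))\<^sup>2 + \<delta>) *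
            sq_trunc k (\<phi> x) * mu_dens A n a x)"
    and "(\<integral>x. ((real CARD('n) - 2) / 2)\<^sup>2 / ((norm (x - p))\<^sup>2 + \<delta>) *
            sq_trunc k (\<phi> x) * mu_dens A n a x \<partial>lebesgue)
     \<le> (\<integral>x. (norm (g x))\<^sup>2 * mu_dens A n a x \<partial>lebesgue)
        + real n / 2 * trace A * (\<integral>x. (\<phi> x)\<^sup>2 * mu_dens A n a x \<partial>lebesgue)"
proof -
  define w where "w = mu_dens A n a"
  define F where "F = hardy_field A n a p \<delta>"
  define b where "b = drift A n a"
  define V where "V x = ((real CARD('n) - 2) / 2)\<^sup>2 / ((norm (x - p))\<^sup>2 + \<delta>)" for x
  define \<kappa> where "\<kappa> = real n / 2 * trace A"
  define S where "S x = sq_trunc k (\<phi> x)" for x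
  have sym: "transpose A = A" using A by (simp add: pos_def_sym_def)
  have \<kappa>: "\<kappa> \<ge> 0" using trace_pos_def_nonneg[OF A] by (simp add: \<kappa>_def)
  have wg: "weak_gradient \<phi> g" and \<phi>2: "integrable lebesgue (\<lambda>x. (\<phi> x)\<^sup>2 * w x)"
    and g2: "integrable lebesgue (\<lambda>x. (norm (g x))\<^sup>2 * w x)"
    using H by (auto simp: H1_mu_def w_def)
  have w0: "w x \<ge> 0" for x by (simp add: w_def mu_dens_nonneg)
  have wc: "continuous_on UNIV w" by (simp add: w_def continuous_on_mu_dens)
  have Fc: "continuous_on UNIV F" using continuous_on_hardy_field[OF \<delta>] by (simp add: F_def)
  have Vc: "continuous_on UNIV V"
    unfolding V_def[abs_def] using hardy_denom[OF \<delta>, where p = p]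
    by (intro continuous_intros) (simp add: less_imp_neq[symmetric])
  have S0: "0 \<le> S x" and S1: "S x \<le> (\<phi> x)\<^sup>2" for x using sq_trunc_bounds[OF k] by (auto simp: S_def)
  have V0: "0 \<le> V x" and V1: "V x \<le> ((real CARD('n) - 2) / 2)\<^sup>2 / \<delta>" for x
    unfolding V_def using hardy_denom[OF \<delta>, of x p] \<delta> by (auto intro!: divide_left_mono divide_nonneg_pos mult_pos_pos)
  have leb: "f \<in> borel_measurable lebesgue" if "continuous_on UNIV f" for f :: "real^'n \<Rightarrow> real"
    using that by (intro measurable_completion) (simp add: borel_measurable_continuous_onI)
  have [measurable]: "\<phi> \<in> borel_measurable lebesgue" "g \<in> borel_measurable lebesgue"
    using wg by (auto simp: weak_gradient_def)
  have Sc: "continuous_on UNIV (sq_trunc k)"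
    using DERIV_sq_trunc[OF k] by (meson DERIV_isCont continuous_at_imp_continuous_on)
  have [measurable]: "sq_trunc k \<in> borel_measurable borel"
    using Sc by (simp add: borel_measurable_continuous_onI)
  have [measurable]: "S \<in> borel_measurable lebesgue" unfolding S_def[abs_def] by measurable
  have [measurable]: "w \<in> borel_measurable lebesgue" "V \<in> borel_measurable lebesgue"
    by (rule leb wc Vc)+
  have Swb: "integrable lebesgue (\<lambda>x. S x * w x * u x)"
    if [measurable]: "u \<in> borel_measurable lebesgue" and u: "\<And>x. \<bar>u x\<bar> \<le> M" for u :: "real^'n \<Rightarrow> real" and M
  proof (rule Bochner_Integration.integrable_bound[OF integrable_mult_right[OF \<phi>2, of M]])
    have "\<bar>S x * w x * u x\<bar> \<le> \<bar>M * ((\<phi> x)\<^sup>2 * w x)\<bar>" for x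
    proof -
      have M: "M \<ge> 0" using u[of x] by simp
      have "(S x * w x) * \<bar>u x\<bar> \<le> ((\<phi> x)\<^sup>2 * w x) * M"
        using S0 S1 w0 u M by (intro mult_mono) auto
      then show ?thesis using S0[of x] w0[of x] M by (simp add: abs_mult mult_ac)
    qed
    then show "AE x in lebesgue. norm (S x * w x * u x) \<le> norm (M * ((\<phi> x)\<^sup>2 * w x))" by simp
  qed measurable
  have iSw: "integrable lebesgue (\<lambda>x. S x * w x)" using Swb[of "\<lambda>_. 1" 1] by simp
  have iV: "integrable lebesgue (\<lambda>x. S x * w x * V x)"
    using V0 V1 by (intro Swb[where M = "((real CARD('n) - 2) / 2)\<^sup>2 / \<delta>"]) auto
  have VSw: "((real CARD('n) - 2) / 2)\<^sup>2 / ((norm (x - p))\<^sup>2 + \<delta>) * sq_trunc k (\<phi> x) * mu_dens A n a x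
      = S x * w x * V x" for x by (simp add: V_def S_def w_def)
  show "integrable lebesgue (\<lambda>x. ((real CARD('n) - 2) / 2)\<^sup>2 / ((norm (x - p))\<^sup>2 + \<delta>) *
            sq_trunc k (\<phi> x) * mu_dens A n a x)"
    unfolding VSw by (rule iV)
  obtain C where C: "C \<ge> 0" "\<And>x. norm (F x) \<le> C * (1 + norm (x - p))"
    using hardy_field_bound[OF \<delta>, of A n a p] unfolding F_def by blast
  \<comment> \<open>The error term left when the derivative falls on the cutoff.\<close>
  define G where "G R x = F x \<bullet> cutoff_grad R (x - p)" for R x
  have Gc: "continuous_on UNIV (G R)" for R
    unfolding G_def[abs_def]
    by (intro continuous_intros Fc continuous_on_compose2[OF continuous_on_cutoff(2)[of UNIV]]) auto
  have chc: "continuous_on UNIV (\<lambda>x. cutoff R (x - p))" for R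
    by (intro continuous_intros continuous_on_compose2[OF continuous_on_cutoff(1)[of UNIV]]) auto
  have [measurable]: "(\<lambda>x. cutoff R (x - p)) \<in> borel_measurable lebesgue" "G R \<in> borel_measurable lebesgue" for R
    by (rule leb Gc chc)+
  have GF: "\<bar>G R x\<bar> \<le> norm (F x) * (4 * norm (x - p) / R\<^sup>2)" for R x
    unfolding G_def by (rule order_trans[OF Cauchy_Schwarz_ineq2 mult_left_mono[OF norm_cutoff_grad_le]]) simp
  \<comment> \<open>On the support, linear growth of \<open>F\<close> meets a gradient of order
    \<open>1 / R\<close>, leaving \<open>4 * C * (1 + R) / R\<close>. This is a bound, not decay;
    decay holds pointwise, and dominated convergence combines the two.\<close>
  have Gb: "\<bar>G R x\<bar> \<le> 8 * C" if R: "R \<ge> 1" for R x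
  proof (cases "norm (x - p) \<ge> R")
    case True
    then show ?thesis using cutoff_eq_0(2)[of R "x - p"] R C(1) by (simp add: G_def)
  next
    case False
    have "\<bar>G R x\<bar> \<le> norm (F x) * (4 * norm (x - p) / R\<^sup>2)" by (rule GF)
    also have "\<dots> \<le> (C * (1 + R)) * (4 * R / R\<^sup>2)"
      using False C R by (intro mult_mono divide_right_mono order_trans[OF C(2)] mult_left_mono) auto
    also have "\<dots> = 4 * C * ((1 + R) / R)" using R by (simp add: power2_eq_square)
    also have "\<dots> \<le> 4 * C * 2" using R C by (intro mult_left_mono) (auto simp: divide_le_eq)
    finally show ?thesis by simp
  qed
  \<comment> \<open>A lower bound for the divergence integrand of total integral 0, obtained from
    the square and \<open>hardy_field_div_ge\<close>. It tends pointwise to the integrand of the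
    desired inequality as \<open>R\<close> grows.\<close>
  define T where "T R x = (S x * w x * (V x - \<kappa>) - (norm (g x))\<^sup>2 * w x) * cutoff R (x - p) + S x * w x * G R x"
    for R x
  define D where "D = (\<lambda>x. (((real CARD('n) - 2) / 2)\<^sup>2 / \<delta> + \<kappa> + 8 * C) * ((\<phi> x)\<^sup>2 * w x) + (norm (g x))\<^sup>2 * w x)"
  have Dint: "integrable lebesgue D" unfolding D_def using \<phi>2 g2 by auto
  have T_bound: "\<bar>T R x\<bar> \<le> D x" if R: "R \<ge> 1" for R x
  proof -
    have "\<bar>V x - \<kappa>\<bar> \<le> ((real CARD('n) - 2) / 2)\<^sup>2 / \<delta> + \<kappa>"
      using V0[of x] V1[of x] \<kappa> by (auto simp: abs_le_iff)
    then have 1: "\<bar>S x * w x * (V x - \<kappa>)\<bar> \<le> ((\<phi> x)\<^sup>2 * w x) * (((real CARD('n) - 2) / 2)\<^sup>2 / \<delta> + \<kappa>)"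
      unfolding abs_mult using S0[of x] S1[of x] w0[of x] by (intro mult_mono) auto
    have 2: "\<bar>S x * w x * G R x\<bar> \<le> ((\<phi> x)\<^sup>2 * w x) * (8 * C)"
      unfolding abs_mult using S0[of x] S1[of x] w0[of x] Gb[OF R, of x] by (intro mult_mono) auto
    have "\<bar>(S x * w x * (V x - \<kappa>) - (norm (g x))\<^sup>2 * w x) * cutoff R (x - p)\<bar>
        \<le> \<bar>S x * w x * (V x - \<kappa>) - (norm (g x))\<^sup>2 * w x\<bar> * 1"
      unfolding abs_mult[of _ "cutoff _ _"] using cutoff_bounds[of R "x - p"] by (intro mult_left_mono) auto
    moreover have "\<bar>(norm (g x))\<^sup>2 * w x\<bar> = (norm (g x))\<^sup>2 * w x" using w0[of x] by simp
    ultimately show ?thesis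
      using 1 2 abs_triangle_ineq4[of "S x * w x * (V x - \<kappa>)" "(norm (g x))\<^sup>2 * w x"]
      unfolding T_def D_def by (simp add: algebra_simps)
  qed
  have Tm[measurable]: "T R \<in> borel_measurable lebesgue" for R
    unfolding T_def[abs_def] by measurable
  have T_le: "(\<integral>x. T R x \<partial>lebesgue) \<le> 0" if R: "R \<ge> 1" for R
  proof -
    \<comment> \<open>Components of the field times density and cutoff; the middle term of
      \<open>\<eta>'\<close> carries the drift through the derivative of the density.\<close>
    define \<eta> where "\<eta> j x = F x $ j * w x * cutoff R (x - p)" for j x
    define \<eta>' where "\<eta>' j x = hardy_field_deriv A n p \<delta> j x * w x * cutoff R (x - p)
        - F x $ j * (w x * b x $ j) * cutoff R (x - p) + F x $ j * w x * cutoff_grad R (x - p) $ j" for j x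
    have e1: "continuous_on UNIV (\<eta> j)" for j
      unfolding \<eta>_def[abs_def] by (intro continuous_intros Fc wc chc)
    have e2: "continuous_on UNIV (\<eta>' j)" for j
      unfolding \<eta>'_def[abs_def] b_def
      by (intro continuous_intros Fc wc chc continuous_on_drift continuous_on_hardy_field_deriv[OF \<delta>]
          continuous_on_compose2[OF continuous_on_cutoff(2)[of UNIV]]) auto
    have far: "norm (x - p) \<ge> R" if "norm x > R + norm p" for x
      using norm_triangle_ineq2[of x p] that by simp
    have e3: "\<eta> j x = 0" if "norm x > R + norm p" for j x
      using cutoff_eq_0(1)[OF _ far[OF that]] R by (simp add: \<eta>_def)
    have e4: "((\<lambda>t. \<eta> j (x + t *\<^sub>R axis j 1)) has_real_derivative \<eta>' j x) (at 0)" for j x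
    proof -
      have c: "((\<lambda>t. cutoff R (x + t *\<^sub>R axis j 1 - p)) has_real_derivative cutoff_grad R (x - p) $ j) (at 0)"
        using DERIV_cutoff[of R "x - p" j] by (simp add: algebra_simps)
      from DERIV_mult[OF DERIV_mult[OF DERIV_hardy_field[OF \<delta>, of A n a p x j] DERIV_mu_dens[OF sym, of n a x j]] c]
      show ?thesis unfolding \<eta>_def \<eta>'_def F_def w_def b_def
        by (simp add: algebra_simps)
    qed
    have e5: "\<eta>' j x = 0" if "norm x > R + norm p" for j x
      using line_DERIV_support[of "\<eta> j" "axis j 1" "\<eta>' j", OF e4 e3 that] .
    have Sk: "\<bar>sq_trunc k s\<bar> \<le> k" for s using sq_trunc_bounds[OF k, of s] by simp
    have int: "integrable lebesgue (\<lambda>x. sq_trunc k (\<phi> x) * \<eta>' j x)"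
      "integrable lebesgue (\<lambda>x. sq_trunc' k (\<phi> x) * (g x $ j * \<eta> j x))" for j
      by (rule weak_chain_rule_integrable[OF wg Sc continuous_on_sq_trunc'[OF k] Sk sq_trunc'_bound[OF k] e1 e2 e3 e5];
          assumption)+
    have parts: "(\<integral>x. S x * \<eta>' j x + sq_trunc' k (\<phi> x) * (g x $ j * \<eta> j x) \<partial>lebesgue) = 0" for j
      unfolding S_def
      using weak_chain_rule[OF wg DERIV_sq_trunc[OF k] continuous_on_sq_trunc'[OF k] Sk sq_trunc'_bound[OF k] e1 e2 e3 e4]
        int by (subst Bochner_Integration.integral_add) auto
    have "0 = (\<integral>x. (\<Sum>j\<in>UNIV. S x * \<eta>' j x + sq_trunc' k (\<phi> x) * (g x $ j * \<eta> j x)) \<partial>lebesgue)"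
      using int by (subst Bochner_Integration.integral_sum) (auto simp: parts[unfolded S_def] S_def simp del: Bochner_Integration.integral_add)
    also have "\<dots> \<ge> (\<integral>x. T R x \<partial>lebesgue)"
    proof (rule integral_mono)
      show "integrable lebesgue (\<lambda>x. \<Sum>j\<in>UNIV. S x * \<eta>' j x + sq_trunc' k (\<phi> x) * (g x $ j * \<eta> j x))"
        unfolding S_def by (intro Bochner_Integration.integrable_sum Bochner_Integration.integrable_add int)
      show "integrable lebesgue (T R)"
        by (rule Bochner_Integration.integrable_bound[OF Dint Tm])
           (use T_bound[OF R] in \<open>auto intro!: order_trans[OF T_bound[OF R] abs_ge_self]\<close>)
      fix x
      define s' ch where "s' = sq_trunc' k (\<phi> x)" and "ch = cutoff R (x - p)"
      have ch: "ch \<ge> 0" by (simp add: ch_def cutoff_bounds)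
      have dot: "u \<bullet> v = (\<Sum>j\<in>UNIV. u $ j * v $ j)" for u v :: "real^'n" by (simp add: inner_vec_def)
      have "(\<Sum>j\<in>UNIV. S x * \<eta>' j x + s' * (g x $ j * \<eta> j x))
        = (S x * ((\<Sum>j\<in>UNIV. hardy_field_deriv A n p \<delta> j x) - F x \<bullet> b x) + s' * (g x \<bullet> F x)) * (w x * ch)
          + S x * w x * G R x"
        unfolding dot G_def \<eta>_def \<eta>'_def ch_def[symmetric]
        by (simp add: sum.distrib sum_subtractf sum_distrib_left sum_distrib_right algebra_simps)
      moreover have "S x * (V x - \<kappa>) - (norm (g x))\<^sup>2
          \<le> S x * ((\<Sum>j\<in>UNIV. hardy_field_deriv A n p \<delta> j x) - F x \<bullet> b x) + s' * (g x \<bullet> F x)"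
      proof -
        \<comment> \<open>Half of \<open>s'\<close> takes the place of \<open>\<phi>\<close>, and
          \<open>sq_trunc'_sq_le\<close> turns its square into \<open>S x\<close>.\<close>
        have "0 \<le> (norm (g x + (s' / 2) *\<^sub>R F x))\<^sup>2" by simp
        also have "\<dots> = (norm (g x))\<^sup>2 + s' * (g x \<bullet> F x) + s'\<^sup>2 / 4 * (norm (F x))\<^sup>2"
          unfolding power2_norm_eq_inner
          by (simp add: inner_add_left inner_add_right inner_commute power2_eq_square algebra_simps)
        also have "s'\<^sup>2 / 4 * (norm (F x))\<^sup>2 \<le> S x * (norm (F x))\<^sup>2"
          using sq_trunc'_sq_le[OF k, of "\<phi> x"] by (intro mult_right_mono) (auto simp: s'_def S_def)
        finally have "- (norm (g x))\<^sup>2 - S x * (norm (F x))\<^sup>2 \<le> s' * (g x \<bullet> F x)" by simp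
        moreover have "S x * (V x - \<kappa>) \<le> S x * ((\<Sum>j\<in>UNIV. hardy_field_deriv A n p \<delta> j x) - F x \<bullet> b x - (norm (F x))\<^sup>2)"
          using hardy_field_div_ge[OF \<delta> N, where A = A and n = n and a = a and p = p and x = x] S0[of x]
          by (intro mult_left_mono) (auto simp: V_def \<kappa>_def F_def b_def)
        ultimately show ?thesis by (simp add: right_diff_distrib)
      qed
      then have "(S x * (V x - \<kappa>) - (norm (g x))\<^sup>2) * (w x * ch)
          \<le> (S x * ((\<Sum>j\<in>UNIV. hardy_field_deriv A n p \<delta> j x) - F x \<bullet> b x) + s' * (g x \<bullet> F x)) * (w x * ch)"
        using w0 ch by (intro mult_right_mono) auto
      ultimately show "T R x \<le> (\<Sum>j\<in>UNIV. S x * \<eta>' j x + sq_trunc' k (\<phi> x) * (g x $ j * \<eta> j x))"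
        unfolding T_def ch_def[symmetric] s'_def[symmetric] by (simp add: algebra_simps)
    qed
    finally show ?thesis by simp
  qed
  have "(\<lambda>m. \<integral>x. T (real (Suc m)) x \<partial>lebesgue) \<longlonglongrightarrow> (\<integral>x. S x * w x * (V x - \<kappa>) - (norm (g x))\<^sup>2 * w x \<partial>lebesgue)"
  proof (rule integral_dominated_convergence[OF _ _ Dint])
    show "AE x in lebesgue. (\<lambda>m. T (real (Suc m)) x) \<longlonglongrightarrow> S x * w x * (V x - \<kappa>) - (norm (g x))\<^sup>2 * w x"
    proof (rule AE_I2)
      fix x
      have "(\<lambda>m. G (real (Suc m)) x) \<longlonglongrightarrow> 0"
      proof (rule Lim_null_comparison)
        show "\<forall>\<^sub>F m in sequentially. norm (G (real (Suc m)) x) \<le> norm (F x) * (4 * norm (x - p)) * (inverse (real (Suc m)))\<^sup>2"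
          using GF[of "real (Suc _)" x] by (simp add: divide_inverse power_inverse mult.assoc)
        have "(\<lambda>m. norm (F x) * (4 * norm (x - p)) * (inverse (real (Suc m)))\<^sup>2)
            \<longlonglongrightarrow> norm (F x) * (4 * norm (x - p)) * 0\<^sup>2"
          by (intro tendsto_intros LIMSEQ_inverse_real_of_nat)
        then show "(\<lambda>m. norm (F x) * (4 * norm (x - p)) * (inverse (real (Suc m)))\<^sup>2) \<longlonglongrightarrow> 0" by simp
      qed
      then have "(\<lambda>m. T (real (Suc m)) x) \<longlonglongrightarrow> (S x * w x * (V x - \<kappa>) - (norm (g x))\<^sup>2 * w x) * 1 + S x * w x * 0"
        unfolding T_def by (intro tendsto_intros cutoff_tendsto)
      then show "(\<lambda>m. T (real (Suc m)) x) \<longlonglongrightarrow> S x * w x * (V x - \<kappa>) - (norm (g x))\<^sup>2 * w x" by simp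
    qed
    show "AE x in lebesgue. norm (T (real (Suc m)) x) \<le> D x" for m
      using T_bound[of "real (Suc m)"] by auto
  qed measurable
  then have "(\<integral>x. S x * w x * (V x - \<kappa>) - (norm (g x))\<^sup>2 * w x \<partial>lebesgue) \<le> 0"
    by (rule LIMSEQ_le_const2) (use T_le in auto)
  also have "(\<integral>x. S x * w x * (V x - \<kappa>) - (norm (g x))\<^sup>2 * w x \<partial>lebesgue)
      = (\<integral>x. S x * w x * V x \<partial>lebesgue) - \<kappa> * (\<integral>x. S x * w x \<partial>lebesgue) - (\<integral>x. (norm (g x))\<^sup>2 * w x \<partial>lebesgue)"
    using iV iSw g2 by (simp add: right_diff_distrib mult.commute[of _ \<kappa>])
  finally have "(\<integral>x. S x * w x * V x \<partial>lebesgue) \<le> (\<integral>x. (norm (g x))\<^sup>2 * w x \<partial>lebesgue) + \<kappa> * (\<integral>x. S x * w x \<partial>lebesgue)"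
    by simp
  \<comment> \<open>The truncation is removed on this side at once, using
    \<open>\<kappa> \<ge> 0\<close>, so the bound no longer depends on \<open>k\<close> or
    \<open>\<delta>\<close>.\<close>
  also have "\<kappa> * (\<integral>x. S x * w x \<partial>lebesgue) \<le> \<kappa> * (\<integral>x. (\<phi> x)\<^sup>2 * w x \<partial>lebesgue)"
    using iSw \<phi>2 \<kappa> S1 w0 by (intro mult_left_mono integral_mono mult_right_mono) auto
  finally show "(\<integral>x. ((real CARD('n) - 2) / 2)\<^sup>2 / ((norm (x - p))\<^sup>2 + \<delta>) *
            sq_trunc k (\<phi> x) * mu_dens A n a x \<partial>lebesgue)
     \<le> (\<integral>x. (norm (g x))\<^sup>2 * mu_dens A n a x \<partial>lebesgue)
        + real n / 2 * trace A * (\<integral>x. (\<phi> x)\<^sup>2 * mu_dens A n a x \<partial>lebesgue)"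
    unfolding VSw by (simp add: w_def \<kappa>_def)
qed


text \<open>The truncated bound is uniform in both parameters, so Fatou's lemma yields the singular
  inequality together with finiteness of its left side.\<close>

lemma hardy_single_pole:
  fixes A :: "real^'n^'n"
  assumes N: "CARD('n) \<ge> 2" and A: "pos_def_sym A" and H: "H1_mu A n a \<phi> g"
  shows "(\<integral>\<^sup>+x. ennreal (((real CARD('n) - 2) / 2)\<^sup>2 * ((\<phi> x)\<^sup>2 / (norm (x - p))\<^sup>2) * mu_dens A n a x) \<partial>lebesgue)
     \<le> ennreal ((\<integral>x. (norm (g x))\<^sup>2 * mu_dens A n a x \<partial>lebesgue)
        + real n / 2 * trace A * (\<integral>x. (\<phi> x)\<^sup>2 * mu_dens A n a x \<partial>lebesgue))" (is "_ \<le> ennreal ?B")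
proof -
  define c w where "c = ((real CARD('n) - 2) / 2)\<^sup>2" and "w = mu_dens A n a"
  have w0: "w x \<ge> 0" for x by (simp add: w_def mu_dens_nonneg)
  have c0: "c \<ge> 0" by (simp add: c_def)
  \<comment> \<open>Both parameters are tied to one index: truncation level \<open>m + 1\<close> and
    regularisation \<open>1 / (m + 1)\<close>.\<close>
  define u where "u m x = c / ((norm (x - p))\<^sup>2 + 1 / real (Suc m)) * sq_trunc (real (Suc m)) (\<phi> x) * w x" for m x
  have ui: "integrable lebesgue (u m)" and uB: "(\<integral>x. u m x \<partial>lebesgue) \<le> ?B" for m
    using hardy_truncated[OF N A H, of "real (Suc m)" "1 / real (Suc m)" p]
    by (auto simp: u_def[abs_def] c_def w_def)
  have u0: "u m x \<ge> 0" for m x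
    unfolding u_def using c0 w0 sq_trunc_bounds(1)[of "real (Suc m)" "\<phi> x"]
    by (intro mult_nonneg_nonneg divide_nonneg_nonneg) auto
  have lim: "(\<lambda>m. u m x) \<longlonglongrightarrow> c * ((\<phi> x)\<^sup>2 / (norm (x - p))\<^sup>2) * w x" if "x \<noteq> p" for x
  proof -
    have inv: "(\<lambda>m. inverse (real (Suc m))) \<longlonglongrightarrow> 0" by (rule LIMSEQ_inverse_real_of_nat)
    have "sq_trunc (real (Suc m)) s = s\<^sup>2 / (1 + s\<^sup>2 * inverse (real (Suc m)))" for m s
    proof -
      have "K * s\<^sup>2 / (K + s\<^sup>2) = s\<^sup>2 / (1 + s\<^sup>2 * inverse K)" if "K > 0" for K :: real
        using that sq_trunc_denom[OF that, of s] by (simp add: field_simps)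
      then show ?thesis by (simp add: sq_trunc_def del: of_nat_Suc)
    qed
    then have "u m x = c / ((norm (x - p))\<^sup>2 + inverse (real (Suc m))) *
        ((\<phi> x)\<^sup>2 / (1 + (\<phi> x)\<^sup>2 * inverse (real (Suc m)))) * w x" for m
      by (simp add: u_def inverse_eq_divide)
    moreover have "(\<lambda>m. c / ((norm (x - p))\<^sup>2 + inverse (real (Suc m))) *
        ((\<phi> x)\<^sup>2 / (1 + (\<phi> x)\<^sup>2 * inverse (real (Suc m)))) * w x)
        \<longlonglongrightarrow> c / ((norm (x - p))\<^sup>2 + 0) * ((\<phi> x)\<^sup>2 / (1 + (\<phi> x)\<^sup>2 * 0)) * w x"
      using that by (intro tendsto_intros inv) auto
    ultimately show ?thesis by simp
  qed
  have "(\<integral>\<^sup>+x. ennreal (c * ((\<phi> x)\<^sup>2 / (norm (x - p))\<^sup>2) * w x) \<partial>lebesgue)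
      \<le> (\<integral>\<^sup>+x. liminf (\<lambda>m. ennreal (u m x)) \<partial>lebesgue)"
  proof (intro nn_integral_mono)
    fix x
    show "ennreal (c * ((\<phi> x)\<^sup>2 / (norm (x - p))\<^sup>2) * w x) \<le> liminf (\<lambda>m. ennreal (u m x))"
    \<comment> \<open>At the pole, division by zero makes the left side 0, so no null set has to be
      removed.\<close>
    proof (cases "x = p")
      case False
      have "(\<lambda>m. ennreal (u m x)) \<longlonglongrightarrow> ennreal (c * ((\<phi> x)\<^sup>2 / (norm (x - p))\<^sup>2) * w x)"
        by (intro tendsto_intros lim False)
      then show ?thesis by (simp add: lim_imp_Liminf)
    qed simp
  qed
  also have "\<dots> \<le> liminf (\<lambda>m. \<integral>\<^sup>+x. ennreal (u m x) \<partial>lebesgue)"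
    using borel_measurable_integrable[OF ui] by (intro nn_integral_liminf) auto
  also have "\<dots> \<le> ennreal ?B"
  proof (rule Liminf_le)
    show "\<forall>\<^sub>F m in sequentially. (\<integral>\<^sup>+x. ennreal (u m x) \<partial>lebesgue) \<le> ennreal ?B"
      using ui u0 uB by (simp add: nn_integral_eq_integral ennreal_leI)
  qed simp
  finally show ?thesis by (simp add: c_def w_def)
qed

theorem theorem3p2:
  fixes A :: "real^'N^'N" and n :: nat and a :: "nat \<Rightarrow> real^'N"
    and \<phi> :: "real^'N \<Rightarrow> real" and g :: "real^'N \<Rightarrow> real^'N"
  assumes "CARD('N) \<ge> 3" and "n \<ge> 1" and "pos_def_sym A"
    and "H1_mu A n a \<phi> g"
  shows "(\<integral>\<^sup>+ x. ennreal ((((real CARD('N) - 2) / 2)\<^sup>2 / real n) *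
              (\<Sum>i=1..n. (\<phi> x)\<^sup>2 / (norm (x - a i))\<^sup>2) * mu_dens A n a x) \<partial>lebesgue)
         \<le> ennreal ((\<integral>x. (norm (g x))\<^sup>2 * mu_dens A n a x \<partial>lebesgue)
              + real n / 2 * trace A * (\<integral>x. (\<phi> x)\<^sup>2 * mu_dens A n a x \<partial>lebesgue))"
  (is "_ \<le> ennreal ?B")
proof -
  let ?c = "((real CARD('N) - 2) / 2)\<^sup>2"
  define u where "u i x = ?c * ((\<phi> x)\<^sup>2 / (norm (x - a i))\<^sup>2) * mu_dens A n a x" for i x
  have leb: "f \<in> borel_measurable lebesgue" if "continuous_on UNIV f" for f :: "real^'N \<Rightarrow> real"
    using that by (intro measurable_completion) (simp add: borel_measurable_continuous_onI)
  have [measurable]: "\<phi> \<in> borel_measurable lebesgue"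
    using assms(4) by (auto simp: H1_mu_def weak_gradient_def)
  have [measurable]: "mu_dens A n a \<in> borel_measurable lebesgue" "(\<lambda>x. norm (x - a i)) \<in> borel_measurable lebesgue" for i
    by (rule leb continuous_on_mu_dens | intro leb continuous_intros)+
  have [measurable]: "u i \<in> borel_measurable lebesgue" for i unfolding u_def[abs_def] by measurable
  have u0: "u i x \<ge> 0" for i x by (simp add: u_def mu_dens_nonneg)
  have avg: "ennreal ((?c / real n) * (\<Sum>i=1..n. (\<phi> x)\<^sup>2 / (norm (x - a i))\<^sup>2) * mu_dens A n a x)
      = (\<Sum>i=1..n. ennreal (1 / real n) * ennreal (u i x))" for x
  proof -
    have "(?c / real n) * (\<Sum>i=1..n. (\<phi> x)\<^sup>2 / (norm (x - a i))\<^sup>2) * mu_dens A n a x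
        = (\<Sum>i=1..n. 1 / real n * u i x)"
      by (simp add: u_def sum_distrib_left sum_distrib_right mult_ac)
    also have "ennreal \<dots> = (\<Sum>i=1..n. ennreal (1 / real n * u i x))"
      using u0 by (intro sum_ennreal[symmetric]) simp
    also have "\<dots> = (\<Sum>i=1..n. ennreal (1 / real n) * ennreal (u i x))"
      using u0 by (intro sum.cong ennreal_mult) auto
    finally show ?thesis .
  qed
  have "(\<integral>\<^sup>+ x. ennreal ((?c / real n) *
              (\<Sum>i=1..n. (\<phi> x)\<^sup>2 / (norm (x - a i))\<^sup>2) * mu_dens A n a x) \<partial>lebesgue)
      = (\<integral>\<^sup>+ x. (\<Sum>i=1..n. ennreal (1 / real n) * ennreal (u i x)) \<partial>lebesgue)"
    unfolding avg ..
  also have "\<dots> = (\<Sum>i=1..n. ennreal (1 / real n) * (\<integral>\<^sup>+ x. ennreal (u i x) \<partial>lebesgue))"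
    by (simp add: nn_integral_sum nn_integral_cmult)
  \<comment> \<open>The bound \<open>?B\<close> is the same for every pole, so n copies of weight
    \<open>1 / n\<close> add up to it.\<close>
  also have "\<dots> \<le> (\<Sum>i=1..n. ennreal (1 / real n) * ennreal ?B)"
    unfolding u_def using assms by (intro sum_mono mult_left_mono hardy_single_pole) auto
  also have "\<dots> = (of_nat n * ennreal (1 / real n)) * ennreal ?B"
    by (simp add: mult.assoc)
  also have "of_nat n * ennreal (1 / real n) = 1"
    using \<open>n \<ge> 1\<close> by (simp add: ennreal_of_nat_eq_real_of_nat ennreal_mult[symmetric])
  finally show ?thesis by simp
qed

end
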